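(* Let $(X,d)$ be a compact length space and let $\{\mu_t\}_{t\in[0,1]}$ be a geodesic path in $P_2(X)$. Then there exists some optimal dynamical transference plan $\Pi$ such that $\{\mu_t\}_{t\in[0,1]}$ is the displacement interpolation associated to $\Pi$.
   Context: A length space is a metric space in which the distance between two points is the infimum of lengths of curves joining them. $P_2(X)$ is the set of Borel probability measures on $X$ with the quadratic Wasserstein metric $W_2(\mu_0,\mu_1)^2=\inf_\pi\int_{X\times X}d(x_0,x_1)^2\,d\pi(x_0,x_1)$, $\pi$ ranging over transference plans, i.e. Borel probability measures on $X\times X$ with marginals $\mu_0,\mu_1$; a minimizing $\pi$ is called optimal. A geodesic path $\{\mu_t\}_{t\in[0,1]}$ in $P_2(X)$ is a minimizing geodesic, parametrized so that $W_2(\mu_t,\mu_{t'})=|t-t'|W_2(\mu_0,\mu_1)$ for all $t,t'\in[0,1]$. $\Gamma$ denotes the set of minimizing geodesics $\gamma:[0,1]\to X$ (parametrized so that $d(\gamma(t),\gamma(t'))=|t-t'|d(\gamma(0),\gamma(1))$), with the uniform topology. For $t\in[0,1]$, $e_t:\Gamma\to X$ is $e_t(\gamma)=\gamma(t)$, and $E:\Gamma\to X\times X$ is $E(\gamma)=(\gamma(0),\gamma(1))$. A dynamical transference plan consists of a transference plan $\pi$ and a Borel (probability) measure $\Pi$ on $\Gamma$ with $E_*\Pi=\pi$; it is optimal if $\pi$ is an optimal transference plan (between its marginals). The displacement interpolation associated to $\Pi$ is the family $\{(e_t)_*\Pi\}_{t\in[0,1]}$. *)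

theory Defs
  imports "HOL-Probability.Probability"
begin

text \<open>The underlying metric space is the whole of a type of class \<^class>\<open>metric_space\<close>;
  compactness is \<open>compact UNIV\<close>. Measures on the space have the sigma-algebra of \<^const>\<open>borel\<close>.\<close>

section \<open>Length spaces\<close>

definition curve_length :: "(real \<Rightarrow> 'a::metric_space) \<Rightarrow> ennreal" where
  "curve_length \<gamma> =
    (SUP (n, t) \<in> {(n::nat, t::nat \<Rightarrow> real). mono_on {..n} t \<and> t ` {..n} \<subseteq> {0..1}}.
      \<Sum>i<n. ennreal (dist (\<gamma> (t i)) (\<gamma> (t (Suc i)))))"

text \<open>In \<^typ>\<open>ennreal\<close> the infimum of the empty set is \<open>\<infinity>\<close>, so the equation also says that
  any two points are joined by a curve.\<close>

definition length_space :: "'a::metric_space itself \<Rightarrow> bool" where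
  "length_space _ \<longleftrightarrow>
    (\<forall>x y::'a. ennreal (dist x y) =
      (INF \<gamma> \<in> {\<gamma>. path \<gamma> \<and> pathstart \<gamma> = x \<and> pathfinish \<gamma> = y}. curve_length \<gamma>))"


section \<open>The quadratic Wasserstein space\<close>

text \<open>No moment condition is imposed: on a space of finite diameter it would be vacuous.\<close>

definition P2 :: "'a::metric_space measure set" where
  "P2 = space (prob_algebra borel)"

text \<open>\<^term>\<open>borel :: ('a::metric_space \<times> 'a) measure\<close> is the Borel sigma-algebra of the product
  topology, not the product sigma-algebra; the two agree on separable spaces.\<close>

definition transference_plans ::
    "'a::metric_space measure \<Rightarrow> 'a measure \<Rightarrow> ('a \<times> 'a) measure set" where
  "transference_plans \<mu>0 \<mu>1 =
    {\<pi> \<in> space (prob_algebra borel). distr \<pi> borel fst = \<mu>0 \<and> distr \<pi> borel snd = \<mu>1}"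

definition transport_cost :: "('a::metric_space \<times> 'a) measure \<Rightarrow> ennreal" where
  "transport_cost \<pi> = (\<integral>\<^sup>+ (x0, x1). ennreal ((dist x0 x1)\<^sup>2) \<partial>\<pi>)"

text \<open>The infimum is finite for Borel probability measures on a compact space, so that
  \<^const>\<open>enn2real\<close> loses nothing there.\<close>

definition W2 :: "'a::metric_space measure \<Rightarrow> 'a measure \<Rightarrow> real" where
  "W2 \<mu>0 \<mu>1 = sqrt (enn2real (INF \<pi> \<in> transference_plans \<mu>0 \<mu>1. transport_cost \<pi>))"

definition optimal_transference_plan ::
    "'a::metric_space measure \<Rightarrow> 'a measure \<Rightarrow> ('a \<times> 'a) measure \<Rightarrow> bool" where
  "optimal_transference_plan \<mu>0 \<mu>1 \<pi> \<longleftrightarrow>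
    \<pi> \<in> transference_plans \<mu>0 \<mu>1 \<and>
    (\<forall>\<pi>' \<in> transference_plans \<mu>0 \<mu>1. transport_cost \<pi> \<le> transport_cost \<pi>')"

definition P2_geodesic_path :: "(real \<Rightarrow> 'a::metric_space measure) \<Rightarrow> bool" where
  "P2_geodesic_path \<mu> \<longleftrightarrow>
    (\<forall>t \<in> {0..1}. \<mu> t \<in> P2) \<and>
    (\<forall>t \<in> {0..1}. \<forall>t' \<in> {0..1}. W2 (\<mu> t) (\<mu> t') = \<bar>t - t'\<bar> * W2 (\<mu> 0) (\<mu> 1))"


section \<open>The space of geodesics\<close>

text \<open>Maps defined on \<open>[0,1]\<close> are encoded as \<^const>\<open>extensional\<close> functions, i.e. functions that are
  \<^const>\<open>undefined\<close> outside \<open>[0,1]\<close>. The defining equation makes them continuous curves of length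
  \<open>dist (\<gamma> 0) (\<gamma> 1)\<close>.\<close>

definition geodesics :: "(real \<Rightarrow> 'a::metric_space) set" where
  "geodesics =
    {\<gamma> \<in> extensional {0..1}.
      \<forall>t \<in> {0..1}. \<forall>t' \<in> {0..1}. dist (\<gamma> t) (\<gamma> t') = \<bar>t - t'\<bar> * dist (\<gamma> 0) (\<gamma> 1)}"

text \<open>The library metric of \<^const>\<open>cfunspace\<close> is the supremum metric.\<close>

definition geodesic_metric :: "(real \<Rightarrow> 'a::metric_space) metric" where
  "geodesic_metric = submetric (cfunspace (top_of_set {0..1}) euclidean_metric) geodesics"

definition geodesic_borel :: "(real \<Rightarrow> 'a::metric_space) measure" where
  "geodesic_borel =
    sigma (mspace geodesic_metric) {U. openin (mtopology_of geodesic_metric) U}"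

definition geodesic_eval :: "real \<Rightarrow> (real \<Rightarrow> 'a) \<Rightarrow> 'a" where
  "geodesic_eval t \<gamma> = \<gamma> t"

definition geodesic_endpoints :: "(real \<Rightarrow> 'a) \<Rightarrow> 'a \<times> 'a" where
  "geodesic_endpoints \<gamma> = (\<gamma> 0, \<gamma> 1)"


section \<open>Dynamical transference plans\<close>

definition dynamical_transference_plan ::
    "('a::metric_space \<times> 'a) measure \<Rightarrow> (real \<Rightarrow> 'a) measure \<Rightarrow> bool" where
  "dynamical_transference_plan \<pi> \<Theta> \<longleftrightarrow>
    \<pi> \<in> transference_plans (distr \<pi> borel fst) (distr \<pi> borel snd) \<and>
    \<Theta> \<in> space (prob_algebra geodesic_borel) \<and>
    distr \<Theta> borel geodesic_endpoints = \<pi>"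

definition optimal_dynamical_transference_plan ::
    "('a::metric_space \<times> 'a) measure \<Rightarrow> (real \<Rightarrow> 'a) measure \<Rightarrow> bool" where
  "optimal_dynamical_transference_plan \<pi> \<Theta> \<longleftrightarrow>
    dynamical_transference_plan \<pi> \<Theta> \<and>
    optimal_transference_plan (distr \<pi> borel fst) (distr \<pi> borel snd) \<pi>"

definition displacement_interpolation ::
    "(real \<Rightarrow> 'a::metric_space) measure \<Rightarrow> real \<Rightarrow> 'a measure" where
  "displacement_interpolation \<Theta> t = distr \<Theta> borel (geodesic_eval t)"


section \<open>Well-definedness of the push-forwards\<close>

lemma geodesic_continuous_on:
  fixes \<gamma> :: "real \<Rightarrow> 'a::metric_space"
  assumes "\<gamma> \<in> geodesics"
  shows "continuous_on {0..1} \<gamma>"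
proof -
  have "dist (\<gamma> t) (\<gamma> t') = dist (\<gamma> 0) (\<gamma> 1) * dist t t'"
    if "t \<in> {0..1}" "t' \<in> {0..1}" for t t'
    using assms that unfolding geodesics_def dist_real_def mult.commute[of "dist _ _"] by blast
  then have "(dist (\<gamma> 0) (\<gamma> 1))-lipschitz_on {0..1} \<gamma>"
    by (intro lipschitz_onI) (simp_all only: order_refl zero_le_dist)
  then show ?thesis
    by (rule lipschitz_on_continuous_on)
qed

lemma mspace_geodesic_metric: "mspace geodesic_metric = geodesics"
proof -
  have bounded: "Met_TC.mbounded (\<gamma> ` {0..1})"
    if "\<gamma> \<in> geodesics" for \<gamma> :: "real \<Rightarrow> 'a"
  proof -
    have "dist (\<gamma> 0) (\<gamma> t) \<le> dist (\<gamma> 0) (\<gamma> 1)" if "t \<in> {0..1}" for t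
    proof -
      have zero: "(0::real) \<in> {0..1}"
        by simp
      have "dist (\<gamma> 0) (\<gamma> t) = \<bar>0 - t\<bar> * dist (\<gamma> 0) (\<gamma> 1)"
        using \<open>\<gamma> \<in> geodesics\<close> that zero unfolding geodesics_def by blast
      also have "\<dots> \<le> dist (\<gamma> 0) (\<gamma> 1)"
        using that by (intro mult_left_le_one_le) auto
      finally show ?thesis .
    qed
    then have "\<gamma> ` {0..1} \<subseteq> Met_TC.mcball (\<gamma> 0) (dist (\<gamma> 0) (\<gamma> 1))"
      by (auto simp: Met_TC.mcball_def)
    then show ?thesis
      unfolding Met_TC.mbounded_def by blast
  qed
  have extensional: "\<gamma> \<in> extensional {0..1}" if "\<gamma> \<in> geodesics" for \<gamma> :: "real \<Rightarrow> 'a"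
    using that unfolding geodesics_def by blast
  have "geodesics \<subseteq> mspace (cfunspace (top_of_set {0..1}) (euclidean_metric :: 'a metric))"
    using bounded extensional geodesic_continuous_on by auto
  then show ?thesis
    unfolding geodesic_metric_def mspace_submetric by blast
qed

lemma dist_le_mdist_geodesic_metric:
  assumes "\<gamma> \<in> geodesics" "\<gamma>' \<in> geodesics" "t \<in> {0..1}"
  shows "dist (\<gamma> t) (\<gamma>' t) \<le> mdist geodesic_metric \<gamma> \<gamma>'"
proof -
  let ?C = "cfunspace (top_of_set {0..1}) (euclidean_metric :: 'a metric)"
  have "\<gamma> \<in> mspace ?C" "\<gamma>' \<in> mspace ?C"
    using assms mspace_geodesic_metric unfolding geodesic_metric_def mspace_submetric by blast+
  then have "\<forall>x \<in> {0..1}. dist (\<gamma> x) (\<gamma>' x) \<le> mdist ?C \<gamma> \<gamma>'"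
    using cfunspace_mdist_le[of \<gamma> "top_of_set {0..1}" "euclidean_metric :: 'a metric" \<gamma>'
        "mdist ?C \<gamma> \<gamma>'"]
    by (simp del: mspace_cfunspace)
  then show ?thesis
    using assms(3) by (simp add: geodesic_metric_def)
qed

lemma continuous_map_geodesic_eval:
  assumes "t \<in> {0..1}"
  shows "continuous_map (mtopology_of geodesic_metric) (euclidean :: 'a::metric_space topology)
    (geodesic_eval t)"
proof -
  have "Lipschitz_continuous_map geodesic_metric (euclidean_metric :: 'a metric) (geodesic_eval t)"
    unfolding Lipschitz_continuous_map_def
    using dist_le_mdist_geodesic_metric[OF _ _ assms]
    by (auto intro!: exI[of _ 1] simp: geodesic_eval_def mspace_geodesic_metric)
  then show ?thesis
    using Lipschitz_continuous_imp_continuous_map by fastforce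
qed

lemma measurable_geodesic_borel:
  assumes "continuous_map (mtopology_of geodesic_metric) euclidean f"
  shows "f \<in> measurable geodesic_borel borel"
proof (rule borel_measurableI)
  fix S :: "'b set"
  assume "open S"
  then have "openin (mtopology_of geodesic_metric) {\<gamma> \<in> mspace geodesic_metric. f \<gamma> \<in> S}"
    using openin_continuous_map_preimage[OF assms, of S] by simp
  moreover have sub: "{U. openin (mtopology_of geodesic_metric) U} \<subseteq> Pow (mspace geodesic_metric)"
    using openin_subset by fastforce
  moreover have "f -` S \<inter> mspace geodesic_metric = {\<gamma> \<in> mspace geodesic_metric. f \<gamma> \<in> S}"
    by auto
  ultimately show "f -` S \<inter> space geodesic_borel \<in> sets geodesic_borel"
    unfolding geodesic_borel_def space_measure_of[OF sub] sets_measure_of[OF sub]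
    by (auto intro: sigma_sets.Basic)
qed

lemma measurable_geodesic_eval:
  "t \<in> {0..1} \<Longrightarrow> geodesic_eval t \<in> measurable geodesic_borel borel"
  by (intro measurable_geodesic_borel continuous_map_geodesic_eval)

lemma measurable_geodesic_endpoints:
  "(geodesic_endpoints :: (real \<Rightarrow> 'a::metric_space) \<Rightarrow> _) \<in> measurable geodesic_borel borel"
proof -
  have "continuous_map (mtopology_of geodesic_metric)
      (prod_topology (euclidean :: 'a topology) euclidean)
      (\<lambda>\<gamma>. (geodesic_eval 0 \<gamma>, geodesic_eval 1 \<gamma>))"
    by (intro continuous_map_pairedI continuous_map_geodesic_eval) auto
  then show ?thesis
    by (intro measurable_geodesic_borel)
      (simp add: geodesic_eval_def geodesic_endpoints_def[abs_def])
qed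

end

theory Submission
  imports Defs
begin

text \<open>Cut \<open>[0,1]\<close> into \<open>2^k\<close> equal pieces, take almost optimal plans between consecutive measures,
  push them to a finite set by a map that moves points by very little, and glue them to a Markov
  chain, which is elementary since all measures are finitely supported. Sampled at the dyadic times,
  the chains have a weak limit, a process indexed by the dyadic numbers with marginals \<open>\<mu>\<^sub>t\<close> and with
  \<open>E d(x\<^sub>s, x\<^sub>t)\<^sup>2 \<le> (t - s)\<^sup>2 W\<^sup>2\<close>, where \<open>W\<close> is the distance of \<open>\<mu>\<^sub>0\<close> and \<open>\<mu>\<^sub>1\<close>. Since also
  \<open>W\<^sup>2 \<le> E d(x\<^sub>0, x\<^sub>1)\<^sup>2\<close>, the equality case of the triangle and Cauchy-Schwarz inequalities shows
  that almost every path satisfies \<open>d(x\<^sub>s, x\<^sub>t) = |s - t| d(x\<^sub>0, x\<^sub>1)\<close>, so that it extends to a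
  geodesic. No geodesic has to be selected measurably.

  To get the weak limit from Helly's theorem on the real line, sequences of points are coded by real
  numbers, in such a way that the decoding maps are continuous on a compact set of codes.\<close>

section \<open>Coding sequences in a compact metric space by real numbers\<close>

text \<open>The weak limit concerns infinitely many positions at once. Ternary digits of a code
  record in which of countably many small balls each entry of the sequence lies. The coding map may
  be wildly discontinuous; what matters is that decoding is continuous, since then continuous
  functions of the decoded points pass to a weak limit of the codes.

  Gluing needs consecutive discretised plans to agree exactly at their common time; this holds
  because one rounding map is used at all times.

  The rigidity comes from an identity: for 0 < s < 1, a^2/s + c^2/(1-s) equals (a+c)^2 plus a
  nonnegative square term. With a = d(x_0, x_s) and c = d(x_s, x_1) the left side has mean at most
  W^2, while (a+c)^2 has mean at least W^2, so nothing can be lost.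

  Measurable selection is avoided because the codes of good paths form a closed set, a path is
  determined by its dyadic values, and a common Lipschitz bound turns continuity at each dyadic time
  into continuity for the uniform metric.\<close>

lemma uniformly_continuous_on_extends_to_closure:
  fixes f :: "'b::metric_space \<Rightarrow> 'a::metric_space"
  assumes "compact (UNIV :: 'a set)" "uniformly_continuous_on S f"
  obtains g where "continuous_on (closure S) g" "\<And>x. x \<in> S \<Longrightarrow> g x = f x"
proof -
  have "mcomplete_of (euclidean_metric :: 'a metric)"
    using compact_imp_complete[OF assms(1)] by (simp add: mcomplete_of_def)
  moreover have "uniformly_continuous_map (submetric euclidean_metric S) euclidean_metric f"
    using assms(2) by simp
  ultimately obtain g where
    "uniformly_continuous_map (submetric euclidean_metric
       (mtopology_of (euclidean_metric :: 'b metric) closure_of S)) (euclidean_metric :: 'a metric) g"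
    and g: "\<And>x. x \<in> S \<Longrightarrow> g x = f x"
    using uniformly_continuous_map_extends_to_closure_of by metis
  then have "uniformly_continuous_on (closure S) g"
    by simp
  with g show ?thesis
    using that uniformly_continuous_imp_continuous by blast
qed

lemma compact_finite_nets:
  assumes "compact (UNIV :: 'a set)"
  obtains F :: "nat \<Rightarrow> 'a::metric_space set"
  where "\<And>m. finite (F m)" "\<And>m. UNIV = (\<Union>x\<in>F m. ball x (1 / Suc m))"
proof -
  have "\<exists>F::'a set. finite F \<and> UNIV = (\<Union>x\<in>F. ball x (1 / Suc m))" for m :: nat
    using assms unfolding compact_eq_totally_bounded
    by (metis of_nat_0_less_iff subset_UNIV zero_less_Suc top.extremum_uniqueI zero_less_divide_1_iff)
  then show ?thesis
    using that by metis
qed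

text \<open>The sets are the balls of radius 1/(m+1) around finite nets, for all m. For a single m
  these balls already cover the space, so two points with the same memberships lie in a common ball
  and are less than 2/(m+1) apart.\<close>

lemma compact_separating_sets:
  assumes "compact (UNIV :: 'a set)"
  obtains A :: "nat \<Rightarrow> 'a::metric_space set" where
    "\<And>\<epsilon>. \<epsilon> > 0 \<Longrightarrow> \<exists>N. \<forall>x y. (\<forall>i<N. x \<in> A i \<longleftrightarrow> y \<in> A i) \<longrightarrow> dist x y < \<epsilon>"
proof -
  obtain F :: "nat \<Rightarrow> 'a set"
    where F: "\<And>m. finite (F m)" "\<And>m. UNIV = (\<Union>x\<in>F m. ball x (1 / Suc m))"
    using compact_finite_nets[OF assms] by metis
  define \<A> where "\<A> = insert {} (\<Union>m. (\<lambda>x. ball x (1 / Suc m)) ` F m)"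
  have cnt: "countable \<A>"
    unfolding \<A>_def by (intro countable_insert countable_UN countable_image countable_finite F countableI_type)
  define A where "A = from_nat_into \<A>"
  show ?thesis
  proof
    fix \<epsilon> :: real assume "\<epsilon> > 0"
    then obtain m where m: "1 / real (Suc m) < \<epsilon> / 2"
      using nat_approx_posE[of "\<epsilon>/2"] by auto
    define I where "I = (\<lambda>x. to_nat_on \<A> (ball x (1 / Suc m))) ` F m"
    have I: "finite I" unfolding I_def using F(1) by simp
    have "dist x y < \<epsilon>" if xy: "\<forall>i<Suc (Max I). x \<in> A i \<longleftrightarrow> y \<in> A i" for x y
    proof -
      obtain p where p: "p \<in> F m" "x \<in> ball p (1 / Suc m)" using F(2)[of m] by blast
      let ?i = "to_nat_on \<A> (ball p (1 / Suc m))"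
      have "?i \<in> I" using p by (auto simp: I_def)
      then have "?i < Suc (Max I)" using I by (simp add: less_Suc_eq_le)
      moreover have "A ?i = ball p (1 / Suc m)"
        unfolding A_def using cnt(1) by (rule from_nat_into_to_nat_on) (use p in \<open>auto simp: \<A>_def\<close>)
      ultimately have "y \<in> ball p (1 / Suc m)" using xy p by auto
      then show ?thesis using p m dist_triangle2[of x y p] by (auto simp: dist_commute)
    qed
    then show "\<exists>N. \<forall>x y. (\<forall>i<N. x \<in> A i \<longleftrightarrow> y \<in> A i) \<longrightarrow> dist x y < \<epsilon>" by blast
  qed
qed

lemma sums_third_powers: "(\<lambda>i. (1/3::real) ^ (i + m)) sums (3/2 * (1/3) ^ m)"
  using sums_mult[OF geometric_sums[of "1/3::real"], of "(1/3)^m"]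
  by (simp add: power_add mult.commute)

text \<open>In base 3 with digits 0 and 1 nothing is carried: the first differing digit, at position
  m, contributes 3^(-m), and all later digits together can undo at most half of that. In base 2 the
  later digits could cancel it completely.\<close>

lemma ternary_digits_eq:
  fixes a b :: "nat \<Rightarrow> bool"
  assumes "\<bar>(\<Sum>i. of_bool (a i) * (1/3::real) ^ i) - (\<Sum>i. of_bool (b i) * (1/3) ^ i)\<bar> < 1/2 * (1/3) ^ l"
    and "i \<le> l"
  shows "a i = b i"
proof (rule ccontr)
  assume "a i \<noteq> b i"
  then obtain m where m: "a m \<noteq> b m" "\<And>j. j < m \<Longrightarrow> a j = b j" "m \<le> i"
    using LeastI[of "\<lambda>i. a i \<noteq> b i" i] Least_le[of "\<lambda>i. a i \<noteq> b i" i] not_less_Least[of _ "\<lambda>i. a i \<noteq> b i"]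
    by blast
  have sb: "summable (\<lambda>i. of_bool (a i) * (1/3::real) ^ i)" for a :: "nat \<Rightarrow> bool"
    by (rule summable_comparison_test[of _ "\<lambda>i. (1/3::real)^i"])
      (use summable_geometric[of "1/3::real"] in \<open>auto intro!: exI[of _ 0]\<close>)
  define d where "d i = (of_bool (a i) - of_bool (b i)) * (1/3::real) ^ i" for i
  have d: "summable d" "suminf d = (\<Sum>i. of_bool (a i) * (1/3::real) ^ i) - (\<Sum>i. of_bool (b i) * (1/3) ^ i)"
    using summable_diff[OF sb[of a] sb[of b]] suminf_diff[OF sb[of a] sb[of b]]
    unfolding d_def[abs_def] by (simp_all add: left_diff_distrib)
  have dle: "norm (d (j + Suc m)) \<le> (1/3) ^ (j + Suc m)" for j
    by (auto simp: d_def)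
  have sm: "summable (\<lambda>j. norm (d (j + Suc m)))"
    by (rule summable_comparison_test[of _ "\<lambda>j. (1/3::real) ^ (j + Suc m)"])
      (use dle sums_summable[OF sums_third_powers] in auto)
  have "\<bar>\<Sum>j. d (j + Suc m)\<bar> \<le> (\<Sum>j. norm (d (j + Suc m)))"
    using summable_norm[OF sm] by simp
  also have "\<dots> \<le> (\<Sum>j. (1/3) ^ (j + Suc m))"
    by (rule suminf_le[OF dle sm]) (use sums_summable[OF sums_third_powers] in blast)
  also have "\<dots> = 1/2 * (1/3) ^ m"
    using sums_unique[OF sums_third_powers[of "Suc m"]] by simp
  finally have tail: "\<bar>\<Sum>j. d (j + Suc m)\<bar> \<le> 1/2 * (1/3) ^ m" .
  have "suminf d = (\<Sum>j. d (j + Suc m)) + d m"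
    using suminf_split_initial_segment[OF d(1), of "Suc m"] m(2) by (simp add: d_def)
  moreover have "\<bar>d m\<bar> = (1/3) ^ m" using m(1) by (auto simp: d_def)
  ultimately have "1/2 * (1/3::real) ^ m \<le> \<bar>suminf d\<bar>" using tail by linarith
  also have "\<dots> < 1/2 * (1/3) ^ l" using assms(1) d by simp
  also have "\<dots> \<le> 1/2 * (1/3) ^ m"
    using m assms(2) by (intro mult_left_mono power_decreasing) auto
  finally show False by simp
qed

text \<open>Close codes share their first digits, hence the memberships of a given coordinate in
  many of the separating sets, hence decode to close points. So the decoders are uniformly
  continuous on the range of \<open>c\<close> and extend to its closure, which is compact because
  the digit sums are bounded by 3/2.\<close>

lemma compact_sequence_coding:
  assumes "compact (UNIV :: 'a set)"
  obtains c :: "(nat \<Rightarrow> 'a::metric_space) \<Rightarrow> real" and f :: "nat \<Rightarrow> real \<Rightarrow> 'a" and C :: "real set"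
  where "compact C" "\<And>x. c x \<in> C" "\<And>x n. f n (c x) = x n" "\<And>n. continuous_on C (f n)"
proof -
  obtain A :: "nat \<Rightarrow> 'a set" where
    A: "\<And>\<epsilon>. \<epsilon> > 0 \<Longrightarrow> \<exists>N. \<forall>x y. (\<forall>i<N. x \<in> A i \<longleftrightarrow> y \<in> A i) \<longrightarrow> dist x y < \<epsilon>"
    using compact_separating_sets[OF assms] by blast
  define B where "B x l \<longleftrightarrow> x (fst (prod_decode l)) \<in> A (snd (prod_decode l))" for x :: "nat \<Rightarrow> 'a" and l
  define c where "c x = (\<Sum>l. of_bool (B x l) * (1/3::real) ^ l)" for x
  have uc: "\<exists>\<delta>>0. \<forall>x y. \<bar>c x - c y\<bar> < \<delta> \<longrightarrow> dist (x n) (y n) < \<epsilon>" if "\<epsilon> > 0" for \<epsilon> n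
  proof -
    obtain N where N: "\<And>x y. (\<forall>i<N. x \<in> A i \<longleftrightarrow> y \<in> A i) \<Longrightarrow> dist x y < \<epsilon>"
      using A[OF \<open>\<epsilon> > 0\<close>] by metis
    \<comment> \<open>The last digit position that stores one of the first N memberships of
      coordinate n; the inserted 0 covers N = 0.\<close>
    define l where "l = Max (insert 0 ((\<lambda>i. prod_encode (n, i)) ` {..<N}))"
    have "dist (x n) (y n) < \<epsilon>" if xy: "\<bar>c x - c y\<bar> < 1/2 * (1/3) ^ l" for x y
    proof (intro N allI impI)
      fix i assume "i < N"
      then have "prod_encode (n, i) \<le> l" unfolding l_def by (intro Max_ge) auto
      from ternary_digits_eq[OF xy[unfolded c_def] this]
      show "x n \<in> A i \<longleftrightarrow> y n \<in> A i" by (simp add: B_def)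
    qed
    then show ?thesis by (intro exI[of _ "1/2 * (1/3) ^ l"]) auto
  qed
  \<comment> \<open>The choice of a preimage is harmless: by \<open>uc\<close>, equal codes have
    equal coordinates.\<close>
  define \<phi> where "\<phi> n z = (SOME x. c x = z) n" for n z
  have \<phi>: "\<phi> n (c x) = x n" for n x
  proof (rule ccontr)
    assume "\<phi> n (c x) \<noteq> x n"
    then have "dist (\<phi> n (c x)) (x n) > 0" by simp
    moreover have "c (SOME y. c y = c x) = c x" by (rule someI[of "\<lambda>y. c y = c x"]) simp
    ultimately show False using uc[of "dist (\<phi> n (c x)) (x n)" n] unfolding \<phi>_def
      by (metis abs_zero diff_self order_less_irrefl)
  qed
  have "uniformly_continuous_on (range c) (\<phi> n)" for n
    unfolding uniformly_continuous_on_def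
  proof (intro allI impI)
    fix \<epsilon> :: real assume "\<epsilon> > 0"
    from uc[OF this, of n] show "\<exists>d>0. \<forall>x\<in>range c. \<forall>x'\<in>range c. dist x' x < d \<longrightarrow> dist (\<phi> n x') (\<phi> n x) < \<epsilon>"
      by (auto simp: \<phi> dist_real_def)
  qed
  then have "\<exists>g. continuous_on (closure (range c)) g \<and> (\<forall>x\<in>range c. g x = \<phi> n x)" for n
    using uniformly_continuous_on_extends_to_closure[OF assms] by metis
  then obtain f where f: "\<And>n. continuous_on (closure (range c)) (f n)" "\<And>n x. x \<in> range c \<Longrightarrow> f n x = \<phi> n x"
    by metis
  have "\<bar>c x\<bar> \<le> 3/2" for x
  proof -
    have s: "summable (\<lambda>l. norm (of_bool (B x l) * (1/3::real) ^ l))"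
      by (rule summable_comparison_test[of _ "\<lambda>i. (1/3::real)^i"])
      (use summable_geometric[of "1/3::real"] in \<open>auto intro!: exI[of _ 0]\<close>)
    have "\<bar>c x\<bar> \<le> (\<Sum>l. norm (of_bool (B x l) * (1/3::real) ^ l))"
      unfolding c_def using summable_norm[OF s] by simp
    also have "\<dots> \<le> (\<Sum>l. (1/3::real) ^ l)"
      by (rule suminf_le[OF _ s]) (auto intro: summable_geometric)
    finally show ?thesis by (simp add: suminf_geometric)
  qed
  then have "bounded (range c)" unfolding bounded_iff by (intro exI[of _ "3/2"]) auto
  then have "compact (closure (range c))" by simp
  then show ?thesis
    by (rule that[of _ c f]) (use f \<phi> in \<open>auto intro: subsetD[OF closure_subset]\<close>)
qed

section \<open>Gluing discrete couplings\<close>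

text \<open>One Markov step: y is drawn from the conditional law under \<rho> of the second
  coordinate, given that the first one equals \<open>g w\<close>. The conditioning is on an atom, so
  no disintegration theorem is involved.\<close>

lemma pmf_gluing_step:
  fixes P :: "'b pmf" and \<rho> :: "('a \<times> 'c) pmf"
  assumes "map_pmf g P = map_pmf fst \<rho>"
  obtains Q :: "('b \<times> 'c) pmf" where "map_pmf fst Q = P" "map_pmf (\<lambda>(w, y). (g w, y)) Q = \<rho>"
proof
  define K where "K x = map_pmf snd (cond_pmf \<rho> {p. x = fst p})" for x
  define Q where "Q = bind_pmf P (\<lambda>w. map_pmf (Pair w) (K (g w)))"
  show "map_pmf fst Q = P"
    unfolding Q_def by (simp add: map_bind_pmf map_pmf_comp bind_return_pmf')
  have "map_pmf (\<lambda>(w, y). (g w, y)) Q = bind_pmf P (\<lambda>w. map_pmf (Pair (g w)) (K (g w)))"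
    unfolding Q_def by (simp add: map_bind_pmf map_pmf_comp)
  also have "\<dots> = bind_pmf (map_pmf fst \<rho>) (\<lambda>x. map_pmf (Pair x) (K x))"
    unfolding assms[symmetric] by (simp add: bind_map_pmf)
  also have "\<dots> = bind_pmf (map_pmf fst \<rho>) (\<lambda>x. cond_pmf \<rho> {p. x = fst p})"
  proof (rule bind_pmf_cong[OF refl])
    fix x assume "x \<in> set_pmf (map_pmf fst \<rho>)"
    then have "set_pmf \<rho> \<inter> {p. x = fst p} \<noteq> {}" by auto
    then have "set_pmf (cond_pmf \<rho> {p. x = fst p}) \<subseteq> {p. x = fst p}" by simp
    then show "map_pmf (Pair x) (K x) = cond_pmf \<rho> {p. x = fst p}"
      unfolding K_def map_pmf_comp by (intro pmf.map_ident_strong) auto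
  qed
  also have "\<dots> = \<rho>"
  proof (rule bind_cond_pmf_cancel)
    fix x p assume "x \<in> set_pmf (map_pmf fst \<rho>)" "p \<in> set_pmf \<rho>" "x = fst p"
    have "measure (map_pmf fst \<rho>) {x. x = fst p} = measure \<rho> (fst -` {fst p})"
      by simp
    also have "fst -` {fst p} = {y. x = fst y}" using \<open>x = fst p\<close> by auto
    finally show "measure \<rho> {y. x = fst y} = measure (map_pmf fst \<rho>) {x. x = fst p}" by simp
  qed force+
  finally show "map_pmf (\<lambda>(w, y). (g w, y)) Q = \<rho>" .
qed

lemma pmf_chain_gluing:
  fixes \<rho> :: "nat \<Rightarrow> ('a \<times> 'a) pmf"
  assumes "\<And>i. Suc i < N \<Longrightarrow> map_pmf snd (\<rho> i) = map_pmf fst (\<rho> (Suc i))"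
  shows "\<exists>P. \<forall>i<N. map_pmf (\<lambda>w. (w i, w (Suc i))) P = \<rho> i"
  using assms
proof (induction N)
  case 0
  then show ?case by simp
next
  case (Suc N)
  then obtain P where P: "\<And>i. i < N \<Longrightarrow> map_pmf (\<lambda>w. (w i, w (Suc i))) P = \<rho> i"
    by fastforce
  \<comment> \<open>The next transition has to start from the law of the current last state. For N =
    0 no transition has fixed the law of \<open>w 0\<close> yet, so constant sequences drawn from
    the first marginal of the first plan serve as the start.\<close>
  have "\<exists>P'. (\<forall>i<N. map_pmf (\<lambda>w. (w i, w (Suc i))) P' = \<rho> i) \<and>
    map_pmf (\<lambda>w. w N) P' = map_pmf fst (\<rho> N)"
  proof (cases N)
    case 0
    show ?thesis
      by (rule exI[of _ "map_pmf (\<lambda>p n. fst p) (\<rho> N)"]) (simp add: 0 map_pmf_comp)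
  next
    case (Suc M)
    have "map_pmf (\<lambda>w. w N) P = map_pmf snd (map_pmf (\<lambda>w. (w M, w (Suc M))) P)"
      by (simp add: map_pmf_comp Suc)
    also have "\<dots> = map_pmf fst (\<rho> N)"
      using P[of M] Suc.prems[of M] Suc by simp
    finally show ?thesis using P by blast
  qed
  then obtain P' where P': "\<And>i. i < N \<Longrightarrow> map_pmf (\<lambda>w. (w i, w (Suc i))) P' = \<rho> i"
    "map_pmf (\<lambda>w. w N) P' = map_pmf fst (\<rho> N)"
    by blast
  obtain Q where Q: "map_pmf fst Q = P'" "map_pmf (\<lambda>(w, y). (w N, y)) Q = \<rho> N"
    using pmf_gluing_step[OF P'(2)] by blast
  show ?case
  proof (intro exI[of _ "map_pmf (\<lambda>(w, y). w(Suc N := y)) Q"] allI impI)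
    fix i assume "i < Suc N"
    then consider "i < N" | "i = N" by linarith
    then show "map_pmf (\<lambda>w. (w i, w (Suc i))) (map_pmf (\<lambda>(w, y). w(Suc N := y)) Q) = \<rho> i"
    proof cases
      case 1
      then have "map_pmf (\<lambda>w. (w i, w (Suc i))) (map_pmf (\<lambda>(w, y). w(Suc N := y)) Q)
        = map_pmf (\<lambda>w. (w i, w (Suc i))) (map_pmf fst Q)"
        unfolding map_pmf_comp by (intro map_pmf_cong) auto
      then show ?thesis using 1 P' Q by simp
    next
      case 2
      then have "map_pmf (\<lambda>w. (w i, w (Suc i))) (map_pmf (\<lambda>(w, y). w(Suc N := y)) Q)
        = map_pmf (\<lambda>(w, y). (w N, y)) Q"
        unfolding map_pmf_comp by (intro map_pmf_cong) auto
      then show ?thesis using 2 Q by simp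
    qed
  qed
qed

section \<open>Borel measures on compact metric spaces\<close>

text \<open>A point goes to the first entry of a fixed list of net points that is closer than
  \<epsilon>. Taking the first one keeps the map Borel, since \<open>find\<close> unfolds to nested
  case distinctions on open conditions.\<close>

lemma compact_discretisation:
  assumes "compact (UNIV :: 'a set)" "\<epsilon> > 0"
  obtains r :: "'a::metric_space \<Rightarrow> 'a"
  where "finite (range r)" "r \<in> measurable borel (count_space UNIV)" "\<And>x. dist (r x) x < \<epsilon>"
proof -
  obtain F :: "'a set" where F: "finite F" "UNIV = (\<Union>x\<in>F. ball x \<epsilon>)"
    using assms unfolding compact_eq_totally_bounded
    by (metis subset_UNIV top.extremum_uniqueI)
  obtain xs where xs: "set xs = F" using finite_list[OF F(1)] by blast
  define r where "r x = the (find (\<lambda>p. dist p x < \<epsilon>) xs)" for x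
  have ex: "\<exists>i<length xs. find (\<lambda>p. dist p x < \<epsilon>) xs = Some (xs ! i) \<and> dist (xs ! i) x < \<epsilon>" for x
  proof -
    have "\<exists>p\<in>set xs. dist p x < \<epsilon>" using F(2) xs by (metis UNIV_I UN_E mem_ball)
    then have "find (\<lambda>p. dist p x < \<epsilon>) xs \<noteq> None" by (auto simp: find_None_iff)
    then show ?thesis by (force simp: find_Some_iff)
  qed
  have rF: "r x \<in> F" for x using ex[of x] xs by (auto simp: r_def)
  show ?thesis
  proof
    show fin: "finite (range r)" using rF F(1) by (meson finite_subset image_subsetI)
    show "dist (r x) x < \<epsilon>" for x using ex[of x] by (auto simp: r_def)
    have [measurable]: "Measurable.pred borel (\<lambda>x. dist p x < \<epsilon>)" for p :: 'a
      using borel_open[OF open_ball[of p \<epsilon>]] by (simp add: pred_def ball_def)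
    have "(\<lambda>x. the (find (\<lambda>p. dist p x < \<epsilon>) ys)) \<in> measurable borel (count_space UNIV)" for ys :: "'a list"
      by (induction ys) (simp_all add: if_distrib[of the] measurable_If)
    then show "r \<in> measurable borel (count_space UNIV)" unfolding r_def[abs_def] .
  qed
qed

text \<open>\<open>Abs_pmf\<close> can be inverted if almost every point has positive mass. Among
  finitely many values, those of mass zero form a null set.\<close>

lemma finite_range_distr_pmf:
  assumes "prob_space M" "f \<in> measurable M (count_space UNIV)" "finite (range f)"
  obtains p where "measure_pmf p = distr M (count_space UNIV) f"
proof -
  let ?D = "distr M (count_space UNIV) f"
  interpret D: prob_space ?D by (rule prob_space.prob_space_distr[OF assms(1,2)])
  have "AE x in ?D. x \<in> range f" using assms(2) by (subst AE_distr_iff) auto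
  moreover have "AE x in ?D. \<forall>y\<in>range f. measure ?D {y} = 0 \<longrightarrow> x \<noteq> y"
    using assms(3) by (subst AE_finite_all) (auto simp: AE_iff_measurable[OF _ refl] D.emeasure_eq_measure
      intro!: AE_I[of _ _ "{_}"])
  ultimately have "AE x in ?D. measure ?D {x} \<noteq> 0" by eventually_elim auto
  then have "measure_pmf (Abs_pmf ?D) = ?D"
    by (intro Abs_pmf_inverse) (simp add: D.prob_space_axioms)
  then show ?thesis using that by blast
qed

text \<open>Bounded Lipschitz functions decrease to the indicator of a closed set, and the closed
  sets are an intersection-stable generator of the Borel sets.\<close>

lemma measure_eqI_lipschitz:
  fixes M N :: "'a::metric_space measure"
  assumes "finite_measure M" "finite_measure N" and sets: "sets M = sets borel" "sets N = sets borel"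
    and eq: "\<And>g L. L-lipschitz_on UNIV g \<Longrightarrow> (\<And>x. \<bar>g x\<bar> \<le> 1) \<Longrightarrow> integral\<^sup>L M g = integral\<^sup>L N (g :: 'a \<Rightarrow> real)"
  shows "M = N"
proof -
  interpret M: finite_measure M by fact
  interpret N: finite_measure N by fact
  have closed: "emeasure M S = emeasure N S" if "closed S" for S
  proof (cases "S = {}")
    case False
    \<comment> \<open>Here \<open>S\<close> is nonempty; \<open>infdist\<close> to the empty set is
      0 and would make this function constantly 1.\<close>
    define g where "g n x = max 0 (1 - real n * infdist x S)" for n x
    have lip: "(real n)-lipschitz_on UNIV (g n)" for n
    proof (rule lipschitz_onI)
      fix x y
      have "dist (g n x) (g n y) \<le> \<bar>real n * infdist x S - real n * infdist y S\<bar>"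
        by (auto simp: g_def dist_real_def)
      also have "\<dots> = real n * \<bar>infdist x S - infdist y S\<bar>"
        by (simp add: abs_mult flip: right_diff_distrib)
      also have "\<dots> \<le> real n * dist x y"
        by (intro mult_left_mono infdist_triangle_abs) auto
      finally show "dist (g n x) (g n y) \<le> real n * dist x y" .
    qed simp
    have bd: "\<bar>g n x\<bar> \<le> 1" for n x by (simp add: g_def infdist_nonneg)
    have meas: "g n \<in> borel_measurable M" "g n \<in> borel_measurable N" for n
      using borel_measurable_continuous_onI[OF lipschitz_on_continuous_on[OF lip[of n]]] sets
      by (simp_all cong: measurable_cong_sets)
    have lim: "(\<lambda>n. g n x) \<longlonglongrightarrow> indicator S x" for x
    proof (cases "x \<in> S")
      case True
      then show ?thesis by (simp add: g_def)
    next
      case x: False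
      then have "infdist x S > 0" using that False by (simp add: in_closed_iff_infdist_zero infdist_nonneg order_less_le)
      then obtain n0 where "1 < real n0 * infdist x S" using reals_Archimedean3 by blast
      then have "g n x = 0" if "n \<ge> n0" for n
        using mult_right_mono[of "real n0" "real n" "infdist x S"] that
        by (auto simp: g_def infdist_nonneg)
      then show ?thesis using x by (intro tendsto_eventually) (auto simp: eventually_sequentially)
    qed
    have S: "S \<in> sets M" "S \<in> sets N" using that sets by auto
    have "(\<lambda>n. integral\<^sup>L M (g n)) \<longlonglongrightarrow> integral\<^sup>L M (indicator S)"
      by (rule integral_dominated_convergence[of _ _ _ "\<lambda>_. 1"]) (use meas lim bd S in auto)
    moreover have "(\<lambda>n. integral\<^sup>L N (g n)) \<longlonglongrightarrow> integral\<^sup>L N (indicator S)"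
      by (rule integral_dominated_convergence[of _ _ _ "\<lambda>_. 1"]) (use meas lim bd S in auto)
    ultimately have "measure M S = measure N S"
      using eq[OF lip bd] LIMSEQ_unique S by (simp add: sets.Int_space_eq2)
    then show ?thesis by (simp add: M.emeasure_eq_measure N.emeasure_eq_measure)
  qed simp
  show ?thesis
  proof (rule measure_eqI_generator_eq[of "Collect closed" UNIV M N "\<lambda>_. UNIV"])
    show "Int_stable (Collect closed)" by (auto simp: Int_stable_def)
    show "sets M = sigma_sets UNIV (Collect closed)" "sets N = sigma_sets UNIV (Collect closed)"
      using sets by (simp_all add: borel_eq_closed)
  qed (use closed in auto)
qed

text \<open>Without second countability of the factors, the projections are not covered by the lemmas on
  product sigma-algebras.\<close>

lemma borel_measurable_fst_snd:
  "fst \<in> borel_measurable (borel :: ('a::topological_space \<times> 'b::topological_space) measure)"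
  "snd \<in> borel_measurable (borel :: ('a \<times> 'b) measure)"
  by (simp_all add: borel_measurable_continuous_onI continuous_on_fst continuous_on_snd continuous_on_id)

text \<open>This lets the product measure be read as a measure on the Borel sets of the product
  space. Balls of radius 1/(m+1) around finite nets form a countable base, so every open set is a
  countable union of open boxes.\<close>

lemma borel_prod_compact:
  assumes "compact (UNIV :: 'a::metric_space set)"
  shows "sets (borel :: ('a \<times> 'a) measure) \<subseteq> sets (borel \<Otimes>\<^sub>M borel)"
proof -
  obtain F :: "nat \<Rightarrow> 'a set"
    where F: "\<And>m. finite (F m)" "\<And>m. UNIV = (\<Union>x\<in>F m. ball x (1 / Suc m))"
    using compact_finite_nets[OF assms] by metis
  have "U \<in> sets (borel \<Otimes>\<^sub>M borel)" if "open U" for U :: "('a \<times> 'a) set"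
  proof -
    define I where "I = {(m, p, q). p \<in> F m \<and> q \<in> F m \<and> ball p (1 / Suc m) \<times> ball q (1 / Suc m) \<subseteq> U}"
    have "I \<subseteq> (SIGMA m:UNIV. F m \<times> F m)" by (auto simp: I_def)
    moreover have "countable (SIGMA m:UNIV. F m \<times> F m)"
      by (intro countable_SIGMA countableI_type countable_finite finite_cartesian_product F)
    ultimately have I: "countable I" by (rule countable_subset)
    have "U = (\<Union>(m, p, q)\<in>I. ball p (1 / Suc m) \<times> ball q (1 / Suc m))"
    proof
      show "U \<subseteq> (\<Union>(m, p, q)\<in>I. ball p (1 / Suc m) \<times> ball q (1 / Suc m))"
      proof clarify
        fix x y assume "(x, y) \<in> U"
        then obtain A B where AB: "open A" "open B" "x \<in> A" "y \<in> B" "A \<times> B \<subseteq> U"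
          using open_prod_elim[OF \<open>open U\<close>] by (metis mem_Sigma_iff)
        then obtain e e' where e: "e > 0" "ball x e \<subseteq> A" "e' > 0" "ball y e' \<subseteq> B"
          by (meson open_contains_ball)
        obtain m where m: "1 / real (Suc m) < min e e' / 2"
          using nat_approx_posE[of "min e e' / 2"] e by auto
        obtain p q where pq: "p \<in> F m" "x \<in> ball p (1 / Suc m)" "q \<in> F m" "y \<in> ball q (1 / Suc m)"
          using F(2)[of m] by blast
        have sub: "ball p d \<subseteq> ball x e" if "x \<in> ball p d" "d < e / 2" for p x :: 'a and d e :: real
        proof
          fix z assume "z \<in> ball p d"
          then show "z \<in> ball x e" using that dist_triangle3[of x z p] by simp
        qed
        have "ball p (1 / Suc m) \<subseteq> ball x e"
          by (rule sub[OF pq(2)]) (use m in simp)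
        moreover have "ball q (1 / Suc m) \<subseteq> ball y e'"
          by (rule sub[OF pq(4)]) (use m in simp)
        ultimately have "ball p (1 / Suc m) \<times> ball q (1 / Suc m) \<subseteq> U" using e AB by blast
        then have "(m, p, q) \<in> I" using pq by (auto simp: I_def)
        then show "(x, y) \<in> (\<Union>(m, p, q)\<in>I. ball p (1 / Suc m) \<times> ball q (1 / Suc m))"
          using pq by blast
      qed
    qed (auto simp: I_def)
    also have "\<dots> \<in> sets (borel \<Otimes>\<^sub>M borel)"
      using I by (intro sets.countable_UN') auto
    finally show ?thesis .
  qed
  then have "sigma_sets (space (borel \<Otimes>\<^sub>M borel)) {U :: ('a \<times> 'a) set. open U} \<subseteq> sets (borel \<Otimes>\<^sub>M borel)"
    by (intro sets.sigma_sets_subset) auto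
  then show ?thesis by (simp add: space_pair_measure sets_borel)
qed

section \<open>Transference plans and the Wasserstein distance\<close>

lemma P2_iff: "\<mu> \<in> P2 \<longleftrightarrow> prob_space \<mu> \<and> sets \<mu> = sets borel"
  by (auto simp: P2_def space_prob_algebra)

lemma transference_plansD:
  assumes "\<pi> \<in> transference_plans \<mu> \<nu>"
  shows "prob_space \<pi>" "sets \<pi> = sets borel" "distr \<pi> borel fst = \<mu>" "distr \<pi> borel snd = \<nu>"
    "fst \<in> borel_measurable \<pi>" "snd \<in> borel_measurable \<pi>"
proof -
  show s: "prob_space \<pi>" "sets \<pi> = sets borel" "distr \<pi> borel fst = \<mu>" "distr \<pi> borel snd = \<nu>"
    using assms by (auto simp: transference_plans_def space_prob_algebra)
  show "fst \<in> borel_measurable \<pi>" "snd \<in> borel_measurable \<pi>"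
    using borel_measurable_fst_snd unfolding measurable_cong_sets[OF s(2) refl] by auto
qed

text \<open>The product measure is a plan. This guards \<open>W2\<close>: over an empty set of plans
  the infimum is infinite, and \<open>enn2real\<close> would turn it into 0.\<close>

lemma transference_plans_nonempty:
  fixes \<mu> \<nu> :: "'a::metric_space measure"
  assumes "compact (UNIV :: 'a set)" "\<mu> \<in> P2" "\<nu> \<in> P2"
  shows "transference_plans \<mu> \<nu> \<noteq> {}"
proof -
  have \<mu>: "prob_space \<mu>" "sets \<mu> = sets borel" and \<nu>: "prob_space \<nu>" "sets \<nu> = sets borel"
    using assms by (auto simp: P2_iff)
  interpret M: prob_space \<mu> by (rule \<mu>)
  interpret N: prob_space \<nu> by (rule \<nu>)
  interpret P: pair_prob_space \<mu> \<nu> ..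
  have id: "(\<lambda>x. x) \<in> measurable (\<mu> \<Otimes>\<^sub>M \<nu>) borel"
  proof (rule measurableI)
    fix A :: "('a \<times> 'a) set" assume "A \<in> sets borel"
    then show "(\<lambda>x. x) -` A \<inter> space (\<mu> \<Otimes>\<^sub>M \<nu>) \<in> sets (\<mu> \<Otimes>\<^sub>M \<nu>)"
      using borel_prod_compact[OF assms(1)] sets_pair_measure_cong[OF \<mu>(2) \<nu>(2)]
      by (auto intro!: sets.Int)
  qed simp
  let ?\<pi> = "distr (\<mu> \<Otimes>\<^sub>M \<nu>) borel (\<lambda>x. x)"
  have "distr ?\<pi> borel fst = distr (\<mu> \<Otimes>\<^sub>M \<nu>) \<mu> fst"
    by (subst distr_distr[OF borel_measurable_fst_snd(1) id]) (auto intro!: distr_cong simp: \<mu>(2))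
  also have "\<dots> = \<mu>" by (rule N.distr_pair_fst)
  finally have 1: "distr ?\<pi> borel fst = \<mu>" .
  have "distr ?\<pi> borel snd = distr (\<mu> \<Otimes>\<^sub>M \<nu>) \<nu> snd"
    by (subst distr_distr[OF borel_measurable_fst_snd(2) id]) (auto intro!: distr_cong simp: \<nu>(2))
  also have "\<dots> = \<nu>"
  proof (rule measure_eqI)
    fix A assume "A \<in> sets (distr (\<mu> \<Otimes>\<^sub>M \<nu>) \<nu> snd)"
    then have A: "A \<in> sets \<nu>" by simp
    have "snd -` A \<inter> space (\<mu> \<Otimes>\<^sub>M \<nu>) = space \<mu> \<times> A"
      using sets.sets_into_space[OF A] by (auto simp: space_pair_measure)
    then show "emeasure (distr (\<mu> \<Otimes>\<^sub>M \<nu>) \<nu> snd) A = emeasure \<nu> A"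
      using A by (simp add: emeasure_distr N.emeasure_pair_measure_Times M.emeasure_space_1)
  qed simp
  finally have 2: "distr ?\<pi> borel snd = \<nu>" .
  have "?\<pi> \<in> transference_plans \<mu> \<nu>"
    using P.prob_space_distr[OF id] 1 2 by (simp add: transference_plans_def space_prob_algebra)
  then show ?thesis by blast
qed

section \<open>Transport cost as a Bochner integral, and estimates through \<open>W2\<close>\<close>

lemma W2_nonneg: "W2 \<mu> \<nu> \<ge> 0"
  by (simp add: W2_def)

context
  fixes D :: real and \<pi> :: "('a::metric_space \<times> 'a) measure"
  assumes D: "\<And>x y :: 'a. dist x y \<le> D"
    and \<pi>: "prob_space \<pi>" "sets \<pi> = sets borel"
begin

lemma borel_measurable_dist_plan: "(\<lambda>(x, y). dist x y) \<in> borel_measurable \<pi>"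
proof -
  have "continuous_on UNIV (\<lambda>p::'a \<times> 'a. dist (fst p) (snd p))" by (intro continuous_intros)
  then have "(\<lambda>(x::'a, y). dist x y) \<in> borel_measurable borel"
    by (simp add: borel_measurable_continuous_onI case_prod_beta)
  then show ?thesis using \<pi> by (simp cong: measurable_cong_sets)
qed

lemma integrable_dist_plan: "integrable \<pi> (\<lambda>(x, y). dist x y)" "integrable \<pi> (\<lambda>(x, y). (dist x y)\<^sup>2)"
proof -
  interpret prob_space \<pi> by (rule \<pi>)
  have sq: "(dist x y)\<^sup>2 \<le> D\<^sup>2" for x y :: 'a
    using D by (intro power_mono) auto
  show "integrable \<pi> (\<lambda>(x, y). dist x y)"
    by (rule integrable_const_bound[of _ D]) (use D borel_measurable_dist_plan in auto)
  show "integrable \<pi> (\<lambda>(x, y). (dist x y)\<^sup>2)"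
    by (rule integrable_const_bound[of _ "D\<^sup>2"])
      (use sq borel_measurable_power[OF borel_measurable_dist_plan, of 2] in \<open>auto simp: case_prod_beta\<close>)
qed

lemma transport_cost_eq_integral: "transport_cost \<pi> = ennreal (\<integral>(x, y). (dist x y)\<^sup>2 \<partial>\<pi>)"
  unfolding transport_cost_def
  by (subst nn_integral_eq_integral[symmetric]) (use integrable_dist_plan in \<open>auto simp: case_prod_unfold\<close>)

end

text \<open>Any plan has finite cost because distances are bounded, so \<open>enn2real\<close> can
  be undone and a plan with slack \<delta> exists by definition of the infimum.\<close>

lemma W2_near_optimal:
  fixes \<mu> \<nu> :: "'a::metric_space measure"
  assumes D: "\<And>x y :: 'a. dist x y \<le> D" and ne: "transference_plans \<mu> \<nu> \<noteq> {}"
    and "\<delta> > 0"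
  obtains \<pi> where "\<pi> \<in> transference_plans \<mu> \<nu>" "(\<integral>(x, y). (dist x y)\<^sup>2 \<partial>\<pi>) < (W2 \<mu> \<nu>)\<^sup>2 + \<delta>"
proof -
  let ?I = "INF \<pi> \<in> transference_plans \<mu> \<nu>. transport_cost \<pi>"
  obtain \<pi>0 where \<pi>0: "\<pi>0 \<in> transference_plans \<mu> \<nu>" using ne by blast
  have "?I \<le> transport_cost \<pi>0" using \<pi>0 by (rule INF_lower)
  also have "\<dots> < top"
    using transport_cost_eq_integral[OF D transference_plansD(1,2)[OF \<pi>0]] by simp
  finally have "?I < top" .
  then have I: "?I = ennreal ((W2 \<mu> \<nu>)\<^sup>2)" by (simp add: W2_def)
  also have "\<dots> < ennreal ((W2 \<mu> \<nu>)\<^sup>2 + \<delta>)" using assms(3) by (intro ennreal_lessI add_nonneg_pos) auto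
  finally obtain \<pi> where \<pi>: "\<pi> \<in> transference_plans \<mu> \<nu>" "transport_cost \<pi> < ennreal ((W2 \<mu> \<nu>)\<^sup>2 + \<delta>)"
    unfolding INF_less_iff by blast
  then have "(\<integral>(x, y). (dist x y)\<^sup>2 \<partial>\<pi>) < (W2 \<mu> \<nu>)\<^sup>2 + \<delta>"
    using transport_cost_eq_integral[OF D transference_plansD(1,2)[OF \<pi>(1)]]
    by (simp add: ennreal_less_iff case_prod_beta)
  then show ?thesis using \<pi>(1) that by blast
qed

lemma W2_le_integral:
  fixes \<mu> \<nu> :: "'a::metric_space measure"
  assumes D: "\<And>x y :: 'a. dist x y \<le> D" and \<pi>: "\<pi> \<in> transference_plans \<mu> \<nu>"
  shows "(W2 \<mu> \<nu>)\<^sup>2 \<le> (\<integral>(x, y). (dist x y)\<^sup>2 \<partial>\<pi>)"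
proof -
  have "(INF \<pi> \<in> transference_plans \<mu> \<nu>. transport_cost \<pi>) \<le> ennreal (\<integral>(x, y). (dist x y)\<^sup>2 \<partial>\<pi>)"
    using INF_lower[OF \<pi>, of transport_cost] transport_cost_eq_integral[OF D transference_plansD(1,2)[OF \<pi>]] by simp
  then have "enn2real (INF \<pi> \<in> transference_plans \<mu> \<nu>. transport_cost \<pi>) \<le> (\<integral>(x, y). (dist x y)\<^sup>2 \<partial>\<pi>)"
    by (rule enn2real_leI[rotated]) (simp add: case_prod_beta)
  then show ?thesis by (simp add: W2_def)
qed

lemma optimal_transference_planI:
  fixes \<mu> \<nu> :: "'a::metric_space measure"
  assumes D: "\<And>x y :: 'a. dist x y \<le> D" and \<pi>: "\<pi> \<in> transference_plans \<mu> \<nu>"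
    and le: "(\<integral>(x, y). (dist x y)\<^sup>2 \<partial>\<pi>) \<le> (W2 \<mu> \<nu>)\<^sup>2"
  shows "optimal_transference_plan \<mu> \<nu> \<pi>"
  unfolding optimal_transference_plan_def
proof (intro conjI ballI \<pi>)
  fix \<pi>' assume \<pi>': "\<pi>' \<in> transference_plans \<mu> \<nu>"
  have "(\<integral>(x, y). (dist x y)\<^sup>2 \<partial>\<pi>) \<le> (\<integral>(x, y). (dist x y)\<^sup>2 \<partial>\<pi>')"
    using le W2_le_integral[OF D \<pi>'] by simp
  then show "transport_cost \<pi> \<le> transport_cost \<pi>'"
    using transport_cost_eq_integral[OF D transference_plansD(1,2)[OF \<pi>]]
      transport_cost_eq_integral[OF D transference_plansD(1,2)[OF \<pi>']] by (simp add: ennreal_leI)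
qed

text \<open>Under a coupling the difference is at most L times the mean distance, which is at most
  the root of the mean squared distance. Along a geodesic path this makes integrals of Lipschitz
  functions Lipschitz in time, which later carries identities from dyadic times to all
  times.\<close>

lemma lipschitz_integral_diff_le_W2:
  fixes \<mu> \<nu> :: "'a::metric_space measure" and g :: "'a \<Rightarrow> real"
  assumes D: "\<And>x y :: 'a. dist x y \<le> D" and ne: "transference_plans \<mu> \<nu> \<noteq> {}"
    and g: "L-lipschitz_on UNIV g" "\<And>x. \<bar>g x\<bar> \<le> B"
  shows "\<bar>integral\<^sup>L \<mu> g - integral\<^sup>L \<nu> g\<bar> \<le> L * W2 \<mu> \<nu>"
proof -
  have L: "L \<ge> 0" using g(1) by (rule lipschitz_on_nonneg)
  have *: "\<bar>integral\<^sup>L \<mu> g - integral\<^sup>L \<nu> g\<bar> \<le> L * (W2 \<mu> \<nu> + \<delta>)" if "\<delta> > 0" for \<delta>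
  proof -
    \<comment> \<open>The slack is \<delta>^2 because W^2 + \<delta>^2 is at most (W +
      \<delta>)^2.\<close>
    obtain \<pi> where \<pi>: "\<pi> \<in> transference_plans \<mu> \<nu>" "(\<integral>(x, y). (dist x y)\<^sup>2 \<partial>\<pi>) < (W2 \<mu> \<nu>)\<^sup>2 + \<delta>\<^sup>2"
      using W2_near_optimal[OF D ne zero_less_power[OF \<open>\<delta> > 0\<close>, of 2]] by blast
    note p = transference_plansD[OF \<pi>(1)]
    interpret prob_space \<pi> by (rule p)
    have gb: "g \<in> borel_measurable borel"
      by (rule borel_measurable_continuous_onI[OF lipschitz_on_continuous_on[OF g(1)]])
    have gm: "(\<lambda>p. g (fst p)) \<in> borel_measurable \<pi>" "(\<lambda>p. g (snd p)) \<in> borel_measurable \<pi>"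
      using measurable_compose[OF p(5) gb] measurable_compose[OF p(6) gb] by auto
    have gi: "integrable \<pi> (\<lambda>p. g (fst p))" "integrable \<pi> (\<lambda>p. g (snd p))"
      by (rule integrable_const_bound[of _ B]; use gm g(2) in auto)+
    note di = integrable_dist_plan[OF D p(1,2)]
    have "integral\<^sup>L \<mu> g = (\<integral>p. g (fst p) \<partial>\<pi>)" "integral\<^sup>L \<nu> g = (\<integral>p. g (snd p) \<partial>\<pi>)"
      using integral_distr[OF p(5) gb] integral_distr[OF p(6) gb] p(3,4) by auto
    then have "\<bar>integral\<^sup>L \<mu> g - integral\<^sup>L \<nu> g\<bar> = \<bar>\<integral>p. g (fst p) - g (snd p) \<partial>\<pi>\<bar>"
      using gi by simp
    also have "\<dots> \<le> (\<integral>p. \<bar>g (fst p) - g (snd p)\<bar> \<partial>\<pi>)" by (rule integral_abs_bound)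
    also have "\<dots> \<le> (\<integral>p. L * (case p of (x, y) \<Rightarrow> dist x y) \<partial>\<pi>)"
      using gi di lipschitz_onD[OF g(1)] by (intro integral_mono) (auto simp: dist_real_def case_prod_unfold)
    also have "\<dots> = L * (\<integral>(x, y). dist x y \<partial>\<pi>)" by simp
    finally have 1: "\<bar>integral\<^sup>L \<mu> g - integral\<^sup>L \<nu> g\<bar> \<le> L * (\<integral>(x, y). dist x y \<partial>\<pi>)" .
    let ?d = "\<lambda>p::'a \<times> 'a. dist (fst p) (snd p)"
    have di': "integrable \<pi> ?d" "integrable \<pi> (\<lambda>p. (?d p)\<^sup>2)"
      using di by (simp_all add: case_prod_unfold)
    \<comment> \<open>Jensen's inequality for the square, in the form that a variance is
      nonnegative.\<close>
    have "(expectation ?d)\<^sup>2 \<le> expectation (\<lambda>p. (?d p)\<^sup>2)"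
      using variance_eq[OF di'] variance_positive[of ?d] by linarith
    then have "(\<integral>(x, y). dist x y \<partial>\<pi>)\<^sup>2 \<le> (\<integral>(x, y). (dist x y)\<^sup>2 \<partial>\<pi>)"
      by (simp add: case_prod_unfold)
    also have "\<dots> \<le> (W2 \<mu> \<nu> + \<delta>)\<^sup>2"
      using \<pi>(2) mult_nonneg_nonneg[OF W2_nonneg[of \<mu> \<nu>] less_imp_le[OF that]]
      by (simp add: power2_sum)
    finally have "(\<integral>(x, y). dist x y \<partial>\<pi>) \<le> W2 \<mu> \<nu> + \<delta>"
      by (rule power2_le_imp_le) (use W2_nonneg[of \<mu> \<nu>] that in linarith)
    from order_trans[OF 1 mult_left_mono[OF this L]] show ?thesis .
  qed
  have "((\<lambda>\<delta>. L * (W2 \<mu> \<nu> + \<delta>)) \<longlongrightarrow> L * (W2 \<mu> \<nu> + 0)) (at_right 0)"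
    by (intro tendsto_intros)
  moreover have "\<forall>\<^sub>F \<delta> in at_right 0. \<bar>integral\<^sup>L \<mu> g - integral\<^sup>L \<nu> g\<bar> \<le> L * (W2 \<mu> \<nu> + \<delta>)"
    using * by (auto simp: eventually_at_filter)
  ultimately have "\<bar>integral\<^sup>L \<mu> g - integral\<^sup>L \<nu> g\<bar> \<le> L * (W2 \<mu> \<nu> + 0)"
    by (rule tendsto_lowerbound) simp
  then show ?thesis by simp
qed

section \<open>Discretised geodesics\<close>

lemma measurable_count_space_finite_range:
  assumes "finite (range f)" "\<And>z. f -` {z} \<inter> space M \<in> sets M"
  shows "f \<in> measurable M (count_space UNIV)"
proof (rule measurableI)
  fix A
  have "f -` A \<inter> space M = (\<Union>z\<in>A \<inter> range f. f -` {z} \<inter> space M)" by auto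
  also have "\<dots> \<in> sets M" using assms by (intro sets.finite_UN) auto
  finally show "f -` A \<inter> space M \<in> sets M" .
qed simp

lemma integrable_pmf_bounded:
  fixes h :: "'b \<Rightarrow> real"
  assumes "\<And>x. \<bar>h x\<bar> \<le> B"
  shows "integrable (measure_pmf P) h"
  by (rule measure_pmf.integrable_const_bound[of _ B]) (use assms in auto)

lemma dist_le_sum_steps:
  fixes w :: "nat \<Rightarrow> 'a::metric_space"
  assumes "i \<le> j"
  shows "dist (w i) (w j) \<le> (\<Sum>l=i..<j. dist (w l) (w (Suc l)))"
  using assms
proof (induction j rule: dec_induct)
  case (step n)
  then show ?case using dist_triangle[of "w i" "w (Suc n)" "w n"] by simp
qed simp

text \<open>Triangle inequality over j - i steps, then Cauchy-Schwarz: one factor j - i comes from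
  squaring the sum, the other from the number of terms. The quadratic growth is exactly that of
  squared distances along a geodesic.\<close>

lemma pmf_chain_dist:
  fixes P :: "(nat \<Rightarrow> 'a::metric_space) pmf"
  assumes D: "\<And>x y :: 'a. dist x y \<le> D"
    and steps: "\<And>l. i \<le> l \<Longrightarrow> l < j \<Longrightarrow> (\<integral>w. (dist (w l) (w (Suc l)))\<^sup>2 \<partial>P) \<le> e"
    and "i \<le> j"
  shows "(\<integral>w. (dist (w i) (w j))\<^sup>2 \<partial>P) \<le> (real (j - i))\<^sup>2 * e"
proof -
  have sq: "\<bar>(dist x y)\<^sup>2\<bar> \<le> D\<^sup>2" for x y :: 'a
    using D by (simp add: power_mono)
  have int: "integrable (measure_pmf P) (\<lambda>w. (dist (w l) (w m))\<^sup>2)" for l m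
    by (rule integrable_pmf_bounded) (rule sq)
  have "(\<integral>w. (dist (w i) (w j))\<^sup>2 \<partial>P) \<le> (\<integral>w. (\<Sum>l=i..<j. (dist (w l) (w (Suc l)))\<^sup>2) * real (j - i) \<partial>P)"
  proof (rule integral_mono)
    fix w :: "nat \<Rightarrow> 'a"
    have "(dist (w i) (w j))\<^sup>2 \<le> (\<Sum>l=i..<j. dist (w l) (w (Suc l)))\<^sup>2"
      using dist_le_sum_steps[OF assms(3), of w] by (intro power_mono) auto
    also have "\<dots> \<le> (\<Sum>l=i..<j. (dist (w l) (w (Suc l)))\<^sup>2) * real (j - i)"
      using sum_squared_le_sum_of_squares[of "\<lambda>l. dist (w l) (w (Suc l))" "{i..<j}"] by simp
    finally show "(dist (w i) (w j))\<^sup>2 \<le> (\<Sum>l=i..<j. (dist (w l) (w (Suc l)))\<^sup>2) * real (j - i)" .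
  qed (auto intro!: integrable_mult_left Bochner_Integration.integrable_sum int)
  also have "\<dots> = (\<Sum>l=i..<j. (\<integral>w. (dist (w l) (w (Suc l)))\<^sup>2 \<partial>P)) * real (j - i)"
    using int by (simp add: Bochner_Integration.integral_sum)
  also have "\<dots> \<le> (\<Sum>l=i..<j. e) * real (j - i)"
    using steps by (intro mult_right_mono sum_mono) auto
  also have "\<dots> = (real (j - i))\<^sup>2 * e" by (simp add: power2_eq_square)
  finally show ?thesis .
qed

text \<open>Near-optimal plans between neighbouring grid times are rounded by one map
  \<open>r\<close> in both coordinates. Hence the plan into a grid time and the plan out of it both
  have the law of \<open>r\<close> under the measure at that time, and the chain can be glued. The
  law estimate costs only the displacement of \<open>r\<close>; the distance estimate is
  \<open>pmf_chain_dist\<close> applied to the single steps.\<close>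

lemma discretised_geodesic_chain:
  fixes \<mu> :: "real \<Rightarrow> 'a::metric_space measure"
  assumes compact: "compact (UNIV :: 'a set)" and geo: "P2_geodesic_path \<mu>"
    and "N > 0" "\<epsilon> > 0" "\<eta> > 0"
  obtains P :: "(nat \<Rightarrow> 'a) pmf" where
    "\<And>i g L B. i \<le> N \<Longrightarrow> L-lipschitz_on UNIV g \<Longrightarrow> (\<And>x. \<bar>g x\<bar> \<le> B) \<Longrightarrow>
      \<bar>(\<integral>w. g (w i) \<partial>P) - integral\<^sup>L (\<mu> (real i / real N)) g\<bar> \<le> L * \<epsilon>"
    "\<And>i j. i \<le> j \<Longrightarrow> j \<le> N \<Longrightarrow>
      (\<integral>w. (dist (w i) (w j))\<^sup>2 \<partial>P) \<le> (real (j - i) / real N)\<^sup>2 * ((W2 (\<mu> 0) (\<mu> 1))\<^sup>2 + \<eta>)"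
proof -
  define W where "W = W2 (\<mu> 0) (\<mu> 1)"
  have geo1: "\<mu> t \<in> P2" if "t \<in> {0..1}" for t
    using geo that unfolding P2_geodesic_path_def by blast
  have geo2: "W2 (\<mu> t) (\<mu> t') = \<bar>t - t'\<bar> * W2 (\<mu> 0) (\<mu> 1)" if "t \<in> {0..1}" "t' \<in> {0..1}" for t t'
    using geo that unfolding P2_geodesic_path_def by blast
  define m where "m i = \<mu> (real i / real N)" for i
  obtain D0 where D0: "\<And>x y :: 'a. dist x y \<le> D0"
    using compact_imp_bounded[OF compact] unfolding bounded_two_points by auto
  \<comment> \<open>The maximum with 1 makes the diameter bound positive, since it is divided by
    below.\<close>
  define D where "D = max D0 1"
  have D: "dist x y \<le> D" "D > 0" for x y :: 'a using D0[of x y] by (auto simp: D_def)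
  have m: "m i \<in> P2" if "i \<le> N" for i
    unfolding m_def by (rule geo1) (use that \<open>N > 0\<close> in simp)
  then have m_sets: "sets (m i) = sets borel" if "i \<le> N" for i
    using that by (simp add: P2_iff)
  have mW: "W2 (m i) (m (Suc i)) = W / N" if "i < N" for i
  proof -
    have "W2 (m i) (m (Suc i)) = \<bar>real i / N - real (Suc i) / N\<bar> * W"
      unfolding m_def W_def by (rule geo2) (use that \<open>N > 0\<close> in simp_all)
    also have "real i / N - real (Suc i) / N = - (1 / N)" by (simp add: diff_divide_distrib[symmetric])
    finally show ?thesis by simp
  qed
  \<comment> \<open>A step may cost up to (W^2 + \<eta>)/N^2. The excess \<eta>/N^2 is split evenly
    between near-optimality of the plan and rounding.\<close>
  define \<eta>' where "\<eta>' = \<eta> / (2 * (real N)\<^sup>2)"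
  have \<eta>': "\<eta>' > 0" using assms by (simp add: \<eta>'_def)
  \<comment> \<open>Rounding changes a distance by at most 2\<epsilon>', hence its square by at most
    4\<epsilon>'D + 4\<epsilon>'^2. The bound by D makes this at most 8D\<epsilon>', and the last
    bound makes that at most \<eta>'.\<close>
  define \<epsilon>' where "\<epsilon>' = min \<epsilon> (min D (\<eta>' / (8 * D)))"
  have \<epsilon>': "\<epsilon>' > 0" "\<epsilon>' \<le> \<epsilon>" "\<epsilon>' \<le> D" "\<epsilon>' \<le> \<eta>' / (8 * D)"
    using \<open>\<epsilon> > 0\<close> D \<eta>' by (auto simp: \<epsilon>'_def)
  have "8 * D * \<epsilon>' \<le> \<eta>'" using \<epsilon>'(4) D(2) by (simp add: field_simps)
  moreover have "4 * \<epsilon>' * \<epsilon>' \<le> 4 * D * \<epsilon>'" using \<epsilon>' by (intro mult_right_mono mult_left_mono) auto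
  ultimately have \<epsilon>'2: "4 * \<epsilon>' * D + 4 * \<epsilon>'\<^sup>2 \<le> \<eta>'"
    by (simp add: power2_eq_square algebra_simps)
  have "\<exists>\<pi>. \<pi> \<in> transference_plans (m i) (m (Suc i)) \<and> (\<integral>(x, y). (dist x y)\<^sup>2 \<partial>\<pi>) < (W / N)\<^sup>2 + \<eta>'" if "i < N" for i
    using W2_near_optimal[OF D(1) transference_plans_nonempty[OF compact m m] \<eta>', of i "Suc i"]
      mW[OF that] that by (metis less_eq_Suc_le less_imp_le_nat)
  then obtain \<pi> where \<pi>: "\<And>i. i < N \<Longrightarrow> \<pi> i \<in> transference_plans (m i) (m (Suc i))"
    "\<And>i. i < N \<Longrightarrow> (\<integral>(x, y). (dist x y)\<^sup>2 \<partial>\<pi> i) < (W / N)\<^sup>2 + \<eta>'"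
    by metis
  obtain r :: "'a \<Rightarrow> 'a" where r: "finite (range r)" "r \<in> measurable borel (count_space UNIV)" "\<And>x. dist (r x) x < \<epsilon>'"
    using compact_discretisation[OF compact \<epsilon>'(1)] by blast
  define rr where "rr p = (r (fst p), r (snd p))" for p
  have rr_fin: "finite (range rr)"
    by (rule finite_subset[of _ "range r \<times> range r"]) (use r(1) in \<open>auto simp: rr_def\<close>)
  have rr_meas: "rr \<in> measurable borel (count_space UNIV)"
  proof (rule measurable_count_space_finite_range[OF rr_fin])
    fix z
    have "(\<lambda>p. r (fst p)) \<in> measurable borel (count_space UNIV)" "(\<lambda>p. r (snd p)) \<in> measurable borel (count_space UNIV)"
      by (rule measurable_compose[OF _ r(2)], rule borel_measurable_fst_snd)+
    from measurable_sets[OF this(1), of "{fst z}"] measurable_sets[OF this(2), of "{snd z}"]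
    have "((\<lambda>p. r (fst p)) -` {fst z} \<inter> space borel) \<inter> ((\<lambda>p. r (snd p)) -` {snd z} \<inter> space borel) \<in> sets borel"
      by (intro sets.Int) auto
    also have "((\<lambda>p. r (fst p)) -` {fst z} \<inter> space borel) \<inter> ((\<lambda>p. r (snd p)) -` {snd z} \<inter> space borel) = rr -` {z} \<inter> space borel"
      by (auto simp: rr_def prod_eq_iff)
    finally show "rr -` {z} \<inter> space borel \<in> sets borel" .
  qed
  have rr_meas': "rr \<in> measurable (\<pi> i) (count_space UNIV)" if "i < N" for i
    using rr_meas transference_plansD(2)[OF \<pi>(1)[OF that]] by (simp cong: measurable_cong_sets)
  have r_meas': "r \<in> measurable (m i) (count_space UNIV)" if "i \<le> N" for i
    using r(2) unfolding measurable_cong_sets[OF m_sets[OF that] refl] .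
  have "\<exists>p. measure_pmf p = distr (\<pi> i) (count_space UNIV) rr" if "i < N" for i
    using finite_range_distr_pmf[OF transference_plansD(1)[OF \<pi>(1)[OF that]] rr_meas'[OF that] rr_fin] by metis
  then obtain \<rho> where \<rho>: "\<And>i. i < N \<Longrightarrow> measure_pmf (\<rho> i) = distr (\<pi> i) (count_space UNIV) rr" by metis
  have \<rho>_fst: "measure_pmf (map_pmf fst (\<rho> i)) = distr (m i) (count_space UNIV) r" if "i < N" for i
  proof -
    note p = transference_plansD[OF \<pi>(1)[OF that]]
    have "measure_pmf (map_pmf fst (\<rho> i)) = distr (\<pi> i) (count_space UNIV) (\<lambda>p. r (fst p))"
      unfolding map_pmf_rep_eq \<rho>[OF that] by (subst distr_distr[OF _ rr_meas'[OF that]]) (auto simp: comp_def rr_def)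
    also have "\<dots> = distr (distr (\<pi> i) borel fst) (count_space UNIV) r"
      by (subst distr_distr[OF r(2) p(5)]) (simp add: comp_def)
    finally show ?thesis by (simp add: p)
  qed
  have \<rho>_snd: "measure_pmf (map_pmf snd (\<rho> i)) = distr (m (Suc i)) (count_space UNIV) r" if "i < N" for i
  proof -
    note p = transference_plansD[OF \<pi>(1)[OF that]]
    have "measure_pmf (map_pmf snd (\<rho> i)) = distr (\<pi> i) (count_space UNIV) (\<lambda>p. r (snd p))"
      unfolding map_pmf_rep_eq \<rho>[OF that] by (subst distr_distr[OF _ rr_meas'[OF that]]) (auto simp: comp_def rr_def)
    also have "\<dots> = distr (distr (\<pi> i) borel snd) (count_space UNIV) r"
      by (subst distr_distr[OF r(2) p(6)]) (simp add: comp_def)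
    finally show ?thesis by (simp add: p)
  qed
  have "map_pmf snd (\<rho> i) = map_pmf fst (\<rho> (Suc i))" if "Suc i < N" for i
    using trans[OF \<rho>_snd[OF Suc_lessD[OF that]] \<rho>_fst[OF that, symmetric]]
    by (rule measure_pmf_inject[THEN iffD1])
  then obtain P where P: "\<And>i. i < N \<Longrightarrow> map_pmf (\<lambda>w. (w i, w (Suc i))) P = \<rho> i"
    using pmf_chain_gluing[of N \<rho>] by blast
  have marg: "measure_pmf (map_pmf (\<lambda>w. w i) P) = distr (m i) (count_space UNIV) r" if "i \<le> N" for i
  proof (cases "i < N")
    case True
    have "map_pmf (\<lambda>w. w i) P = map_pmf fst (map_pmf (\<lambda>w. (w i, w (Suc i))) P)"
      by (simp add: map_pmf_comp)
    then show ?thesis using \<rho>_fst[OF True] by (simp only: P[OF True])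
  next
    case False
    \<comment> \<open>The final time starts no plan; its law is read off as the target of the last
      one.\<close>
    then have "i = Suc (N - 1)" "N - 1 < N" using that \<open>N > 0\<close> by auto
    then obtain k where k: "i = Suc k" "k < N" by blast
    have "map_pmf (\<lambda>w. w i) P = map_pmf snd (map_pmf (\<lambda>w. (w k, w (Suc k))) P)"
      by (simp add: map_pmf_comp k)
    then show ?thesis using \<rho>_snd[OF k(2)] by (simp only: P[OF k(2)] k(1))
  qed
  have step: "(\<integral>w. (dist (w i) (w (Suc i)))\<^sup>2 \<partial>P) \<le> (1 / real N)\<^sup>2 * (W\<^sup>2 + \<eta>)" if "i < N" for i
  proof -
    note p = transference_plansD[OF \<pi>(1)[OF that]]
    interpret prob_space "\<pi> i" by (rule p)
    note di = integrable_dist_plan[OF D(1) p(1,2)]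
    have "(\<integral>w. (dist (w i) (w (Suc i)))\<^sup>2 \<partial>P) = (\<integral>(x, y). (dist x y)\<^sup>2 \<partial>map_pmf (\<lambda>w. (w i, w (Suc i))) P)"
      by simp
    also have "\<dots> = (\<integral>(x, y). (dist x y)\<^sup>2 \<partial>distr (\<pi> i) (count_space UNIV) rr)"
      by (simp add: P that \<rho>)
    also have "\<dots> = (\<integral>p. (dist (r (fst p)) (r (snd p)))\<^sup>2 \<partial>\<pi> i)"
      by (subst integral_distr[OF rr_meas'[OF that]]) (auto simp: rr_def)
    also have "\<dots> \<le> (\<integral>p. (case p of (x, y) \<Rightarrow> (dist x y)\<^sup>2) + \<eta>' \<partial>\<pi> i)"
    proof (rule integral_mono)
      show "integrable (\<pi> i) (\<lambda>p. (dist (r (fst p)) (r (snd p)))\<^sup>2)"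
      proof (rule integrable_const_bound[of _ "D\<^sup>2"])
        show "(\<lambda>p. (dist (r (fst p)) (r (snd p)))\<^sup>2) \<in> borel_measurable (\<pi> i)"
          using measurable_compose[OF rr_meas'[OF that], of "\<lambda>(x, y). (dist x y)\<^sup>2" borel] by (simp add: rr_def)
      qed (use D in \<open>auto intro!: power_mono\<close>)
      show "integrable (\<pi> i) (\<lambda>p. (case p of (x, y) \<Rightarrow> (dist x y)\<^sup>2) + \<eta>')"
        using di by simp
      fix p :: "'a \<times> 'a"
      obtain x y where p: "p = (x, y)" by (cases p)
      have "dist (r x) (r y) \<le> dist x y + 2 * \<epsilon>'"
        using r(3)[of x] r(3)[of y] dist_triangle[of "r x" "r y" x] dist_triangle2[of x "r y" y] by linarith
      then have "(dist (r x) (r y))\<^sup>2 \<le> (dist x y + 2 * \<epsilon>')\<^sup>2" by (intro power_mono) auto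
      also have "\<dots> = (dist x y)\<^sup>2 + (4 * \<epsilon>' * dist x y + 4 * \<epsilon>'\<^sup>2)" by (simp add: power2_sum power_mult_distrib)
      also have "\<dots> \<le> (dist x y)\<^sup>2 + (4 * \<epsilon>' * D + 4 * \<epsilon>'\<^sup>2)"
        using D(1)[of x y] \<epsilon>'(1) by (intro add_left_mono add_right_mono mult_left_mono) auto
      also have "\<dots> \<le> (dist x y)\<^sup>2 + \<eta>'" using \<epsilon>'2 by simp
      finally show "(dist (r (fst p)) (r (snd p)))\<^sup>2 \<le> (case p of (x, y) \<Rightarrow> (dist x y)\<^sup>2) + \<eta>'" by (simp add: p)
    qed
    also have "\<dots> = (\<integral>(x, y). (dist x y)\<^sup>2 \<partial>\<pi> i) + \<eta>'"
      using di by (simp add: prob_space)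
    also have "\<dots> \<le> (W / N)\<^sup>2 + 2 * \<eta>'" using \<pi>(2)[OF that] by simp
    also have "\<dots> = (1 / real N)\<^sup>2 * (W\<^sup>2 + \<eta>)"
      using \<open>N > 0\<close> by (simp add: \<eta>'_def power_divide field_simps)
    finally show ?thesis .
  qed
  show ?thesis
  proof
    fix i and g :: "'a \<Rightarrow> real" and L B
    assume i: "i \<le> N" and g: "L-lipschitz_on UNIV g" "\<And>x. \<bar>g x\<bar> \<le> B"
    interpret prob_space "m i" using m[OF i] by (simp add: P2_iff)
    have gb: "g \<in> borel_measurable (m i)"
      using borel_measurable_continuous_onI[OF lipschitz_on_continuous_on[OF g(1)]]
      unfolding measurable_cong_sets[OF m_sets[OF i] refl] .
    have int: "integrable (m i) g" by (rule integrable_const_bound[of _ B]) (use g gb in auto)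
    have int': "integrable (m i) (\<lambda>x. g (r x))"
      by (rule integrable_const_bound[of _ B]) (use g measurable_compose[OF r_meas'[OF i], of g borel] in auto)
    have "(\<integral>w. g (w i) \<partial>P) = (\<integral>x. g x \<partial>map_pmf (\<lambda>w. w i) P)" by simp
    also have "\<dots> = (\<integral>x. g (r x) \<partial>m i)"
      by (subst marg[OF i], subst integral_distr[OF r_meas'[OF i]]) auto
    finally have "\<bar>(\<integral>w. g (w i) \<partial>P) - integral\<^sup>L (m i) g\<bar> = \<bar>\<integral>x. g (r x) - g x \<partial>m i\<bar>"
      using int int' by simp
    also have "\<dots> \<le> (\<integral>x. \<bar>g (r x) - g x\<bar> \<partial>m i)" by (rule integral_abs_bound)
    also have "\<dots> \<le> (\<integral>x. L * \<epsilon> \<partial>m i)"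
    proof (rule integral_mono)
      fix x
      have "\<bar>g (r x) - g x\<bar> \<le> L * dist (r x) x" using lipschitz_onD[OF g(1), of "r x" x] by (simp add: dist_real_def)
      also have "\<dots> \<le> L * \<epsilon>" using r(3)[of x] \<epsilon>' lipschitz_on_nonneg[OF g(1)] by (intro mult_left_mono) auto
      finally show "\<bar>g (r x) - g x\<bar> \<le> L * \<epsilon>" .
    qed (use int int' in auto)
    also have "\<dots> = L * \<epsilon>" by (simp add: prob_space)
    finally show "\<bar>(\<integral>w. g (w i) \<partial>P) - integral\<^sup>L (\<mu> (real i / real N)) g\<bar> \<le> L * \<epsilon>" by (simp add: m_def)
  next
    fix i j assume "i \<le> j" "j \<le> N"
    then have "(\<integral>w. (dist (w i) (w j))\<^sup>2 \<partial>P) \<le> (real (j - i))\<^sup>2 * ((1 / real N)\<^sup>2 * (W\<^sup>2 + \<eta>))"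
      by (intro pmf_chain_dist[OF D(1)] step) auto
    then show "(\<integral>w. (dist (w i) (w j))\<^sup>2 \<partial>P) \<le> (real (j - i) / real N)\<^sup>2 * ((W2 (\<mu> 0) (\<mu> 1))\<^sup>2 + \<eta>)"
      by (simp add: W_def power_divide)
  qed
qed

section \<open>Weak limits of discrete processes\<close>

text \<open>The codes live in one compact set, so their laws are tight and a subsequence converges
  weakly. Skorohod's representation makes the codes converge pointwise; the decoders are continuous
  on \<open>C\<close>, so dominated convergence applies to any continuous function of two decoded
  entries. No regularity of \<open>c\<close> is needed to push a pmf forward, since every set is
  measurable there.\<close>

lemma pmf_sequence_weak_limit:
  fixes P :: "nat \<Rightarrow> (nat \<Rightarrow> 'a::metric_space) pmf"
  assumes compact: "compact (UNIV :: 'a set)"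
  obtains s and C :: "real set" and M and f :: "nat \<Rightarrow> real \<Rightarrow> 'a" where
    "strict_mono s" "compact C" "prob_space M" "sets M = sets (restrict_space borel C)"
    "\<And>n. continuous_on C (f n)"
    "\<And>h m n. continuous_on UNIV h \<Longrightarrow>
      (\<lambda>k. \<integral>w. h (w m, w n) \<partial>P (s k)) \<longlonglongrightarrow> (\<integral>c. (h (f m c, f n c) :: real) \<partial>M)"
proof -
  obtain c and f :: "nat \<Rightarrow> real \<Rightarrow> 'a" and C where
    C: "compact C" "\<And>x. c x \<in> C" "\<And>x n. f n (c x) = x n" "\<And>n. continuous_on C (f n)"
    using compact_sequence_coding[OF compact] by metis
  define \<nu> where "\<nu> k = distr (measure_pmf (P k)) borel c" for k
  have dist: "real_distribution (\<nu> k)" for k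
    unfolding \<nu>_def by (rule prob_space.real_distribution_distr) (auto intro: prob_space_measure_pmf)
  interpret \<nu>: real_distribution "\<nu> k" for k by (rule dist)
  obtain b where b: "\<And>x. x \<in> C \<Longrightarrow> \<bar>x\<bar> \<le> b"
    using compact_imp_bounded[OF C(1)] by (auto simp: bounded_iff)
  have "tight \<nu>"
    unfolding tight_def
  proof (intro conjI allI impI dist)
    fix \<epsilon> :: real assume "\<epsilon> > 0"
    have "measure (\<nu> k) {-\<bar>b\<bar> - 1 <.. \<bar>b\<bar> + 1} = 1" for k
    proof -
      have "c x \<in> {-\<bar>b\<bar> - 1 <.. \<bar>b\<bar> + 1}" for x
        using b[OF C(2)[of x]] by auto
      then have "c -` {-\<bar>b\<bar> - 1 <.. \<bar>b\<bar> + 1} = UNIV" by auto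
      then show ?thesis by (simp add: \<nu>_def measure_distr)
    qed
    then show "\<exists>a b. a < b \<and> (\<forall>k. measure (\<nu> k) {a<..b} > 1 - \<epsilon>)"
      using \<open>\<epsilon> > 0\<close> by (intro exI[of _ "-\<bar>b\<bar> - 1"] exI[of _ "\<bar>b\<bar> + 1"]) auto
  qed
  then obtain s N where s: "strict_mono s" and N: "real_distribution N" and conv: "weak_conv_m (\<nu> \<circ> s) N"
    using tight_imp_convergent_subsubsequence[of \<nu> id] by (auto simp: strict_mono_id)
  interpret N: real_distribution N by (rule N)
  have "\<exists>(\<Omega> :: real measure) Y Z. prob_space \<Omega> \<and> (\<forall>k. Y k \<in> borel_measurable \<Omega>) \<and>
      (\<forall>k. distr \<Omega> borel (Y k) = \<nu> (s k)) \<and> Z \<in> borel_measurable \<Omega> \<and> distr \<Omega> borel Z = N \<and>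
      (\<forall>x\<in>space \<Omega>. (\<lambda>k. Y k x) \<longlonglongrightarrow> Z x)"
    using Skorohod[OF _ N conv] dist by (simp add: comp_def)
  then obtain \<Omega> :: "real measure" and Y Z where \<Omega>: "prob_space \<Omega>"
    and Y': "\<forall>k. Y k \<in> borel_measurable \<Omega>" "\<forall>k. distr \<Omega> borel (Y k) = \<nu> (s k)"
    and Z: "Z \<in> borel_measurable \<Omega>" "distr \<Omega> borel Z = N"
    and YZ': "\<forall>x\<in>space \<Omega>. (\<lambda>k. Y k x) \<longlonglongrightarrow> Z x"
    by (elim exE conjE) (rule that; assumption)
  note Y = Y'[rule_format] and YZ = YZ'[rule_format]
  interpret \<Omega>: prob_space \<Omega> by (rule \<Omega>)
  have Cb: "C \<in> sets borel" and Ccl: "closed C" using C(1) by (auto intro: compact_imp_closed borel_compact)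
  have pred: "{x \<in> space borel. x \<in> C} \<in> sets borel" using Cb by simp
  have "AE x in \<Omega>. Y k x \<in> C" for k
  proof -
    have "AE z in \<nu> (s k). z \<in> C"
      unfolding \<nu>_def by (subst AE_distr_iff[OF _ pred]) (use C(2) in auto)
    then show ?thesis unfolding Y(2)[symmetric] by (subst (asm) AE_distr_iff[OF Y(1) pred])
  qed
  then have YC: "AE x in \<Omega>. \<forall>k. Y k x \<in> C" by (simp add: AE_all_countable)
  \<comment> \<open>The decoders are controlled only on \<open>C\<close>, so the limit code must
    stay there; it does because \<open>C\<close> is closed.\<close>
  then have ZC: "AE x in \<Omega>. Z x \<in> C"
    using AE_space by eventually_elim (rule closed_sequentially[OF Ccl _ YZ], auto)
  then have "AE z in N. z \<in> C"
    unfolding Z(2)[symmetric] by (subst AE_distr_iff[OF Z(1) pred])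
  then have NC: "emeasure N C = 1" using Cb by (intro N.emeasure_eq_1_AE) auto
  define M where "M = restrict_space N C"
  show ?thesis
  proof
    show "strict_mono s" "compact C" "\<And>n. continuous_on C (f n)" by fact+
    show "prob_space M" unfolding M_def by (rule prob_space_restrict_space) (use Cb NC in auto)
    show "sets M = sets (restrict_space borel C)"
      unfolding M_def by (rule sets_restrict_space_cong) simp
    fix h :: "'a \<times> 'a \<Rightarrow> real" and m n
    assume h: "continuous_on UNIV h"
    have "compact (h ` (UNIV \<times> UNIV))"
      by (intro compact_continuous_image compact_Times compact) (use h in simp)
    then obtain B where B: "\<And>p. \<bar>h p\<bar> \<le> B"
      using compact_imp_bounded by (fastforce simp: bounded_iff)
    \<comment> \<open>Cutting off outside \<open>C\<close> gives a bounded Borel function on the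
      whole line, although the decoders need not be measurable elsewhere.\<close>
    define H where "H z = indicator C z *\<^sub>R h (f m z, f n z)" for z
    have cont: "continuous_on C (\<lambda>z. h (f m z, f n z))"
      by (intro continuous_on_compose2[OF h] continuous_on_Pair C) auto
    have Hm: "H \<in> borel_measurable borel"
      unfolding H_def[abs_def] by (rule borel_measurable_continuous_on_indicator[OF Cb cont])
    have HB: "\<bar>H z\<bar> \<le> B" for z using B[of "(f m z, f n z)"] B[of undefined] by (auto simp: H_def split: split_indicator)
    have "(\<lambda>k. \<integral>x. H (Y k x) \<partial>\<Omega>) \<longlonglongrightarrow> (\<integral>x. H (Z x) \<partial>\<Omega>)"
    proof (rule integral_dominated_convergence[of _ _ _ "\<lambda>_. B"])
      show "AE x in \<Omega>. (\<lambda>k. H (Y k x)) \<longlonglongrightarrow> H (Z x)"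
        using YC ZC AE_space
      proof eventually_elim
        case (elim x)
        then have "(\<lambda>k. h (f m (Y k x), f n (Y k x))) \<longlonglongrightarrow> h (f m (Z x), f n (Z x))"
          using continuous_on_tendsto_compose[OF cont YZ] by auto
        then show ?case using elim by (simp add: H_def)
      qed
    qed (use Hm Y Z HB in auto)
    moreover have "(\<integral>x. H (Y k x) \<partial>\<Omega>) = (\<integral>w. h (w m, w n) \<partial>P (s k))" for k
    proof -
      have "(\<integral>x. H (Y k x) \<partial>\<Omega>) = (\<integral>z. H z \<partial>\<nu> (s k))"
        unfolding Y(2)[symmetric] by (rule integral_distr[OF Y(1) Hm, symmetric])
      also have "\<dots> = (\<integral>w. h (w m, w n) \<partial>P (s k))"
        unfolding \<nu>_def by (subst integral_distr[OF _ Hm]) (auto simp: H_def C)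
      finally show ?thesis .
    qed
    moreover have "(\<integral>x. H (Z x) \<partial>\<Omega>) = (\<integral>z. h (f m z, f n z) \<partial>M)"
    proof -
      have "(\<integral>x. H (Z x) \<partial>\<Omega>) = (\<integral>z. H z \<partial>N)"
        unfolding Z(2)[symmetric] by (rule integral_distr[OF Z(1) Hm, symmetric])
      also have "\<dots> = (\<integral>z. h (f m z, f n z) \<partial>M)"
        unfolding M_def H_def by (rule integral_restrict_space[symmetric]) (use Cb in auto)
      finally show ?thesis .
    qed
    ultimately show "(\<lambda>k. \<integral>w. h (w m, w n) \<partial>P (s k)) \<longlonglongrightarrow> (\<integral>c. h (f m c, f n c) \<partial>M)" by simp
  qed
qed

section \<open>Geodesics determined by a dense set of times\<close>

lemma dense_in_unit_interval_finite_net: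
  fixes q :: "nat \<Rightarrow> real"
  assumes "closure (range q) = {0..1}" "\<eta> > 0"
  obtains J where "finite J" "\<And>t. t \<in> {0..1} \<Longrightarrow> \<exists>n\<in>J. dist (q n) t < \<eta>"
proof -
  have "{0..1} \<subseteq> (\<Union>n\<in>UNIV. ball (q n) \<eta>)"
  proof
    fix t :: real assume "t \<in> {0..1}"
    then have "t \<in> closure (range q)" using assms by simp
    then show "t \<in> (\<Union>n\<in>UNIV. ball (q n) \<eta>)"
      using assms(2) by (auto simp: closure_approachable)
  qed
  then obtain J where "finite J" "{0..1} \<subseteq> (\<Union>n\<in>J. ball (q n) \<eta>)"
    using compactE_image[of "{0..1::real}" UNIV "\<lambda>n. ball (q n) \<eta>"] by auto
  then show ?thesis using that[of J] by fastforce
qed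

text \<open>On the dense set of times the path is Lipschitz, so it extends continuously to the
  interval; the geodesic equation equates continuous functions of two times and survives passage to
  the closure.\<close>

lemma geodesic_extension:
  fixes q :: "nat \<Rightarrow> real" and x :: "nat \<Rightarrow> 'a::metric_space"
  assumes compact: "compact (UNIV :: 'a set)"
    and q: "closure (range q) = {0..1}" "q i0 = 0" "q i1 = 1"
    and x: "\<And>m n. dist (x m) (x n) = \<bar>q m - q n\<bar> * dist (x i0) (x i1)"
  obtains \<gamma> where "\<gamma> \<in> geodesics" "\<And>n. \<gamma> (q n) = x n"
proof -
  define K where "K = dist (x i0) (x i1)"
  have xK: "dist (x m) (x n) = \<bar>q m - q n\<bar> * K" for m n
    unfolding K_def by (rule x)
  \<comment> \<open>Times may repeat in \<open>q\<close>. The choice of an index is harmless, since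
    equal times are at distance 0 by \<open>xK\<close>.\<close>
  define \<phi> where "\<phi> t = x (SOME n. q n = t)" for t
  have \<phi>: "\<phi> (q n) = x n" for n
  proof -
    have "q (SOME m. q m = q n) = q n" by (rule someI[of "\<lambda>m. q m = q n"]) simp
    then show ?thesis using xK[of "SOME m. q m = q n" n] by (simp add: \<phi>_def)
  qed
  have "K-lipschitz_on (range q) \<phi>"
    by (rule lipschitz_onI) (auto simp: \<phi> xK dist_real_def mult.commute[of K], simp add: K_def)
  then obtain g where g: "continuous_on {0..1} g" "\<And>n. g (q n) = x n"
    using uniformly_continuous_on_extends_to_closure[OF compact lipschitz_on_uniformly_continuous] q(1) \<phi>
    by (metis rangeI)
  have "dist (g t) (g t') - \<bar>t - t'\<bar> * K = 0" if "t \<in> {0..1}" "t' \<in> {0..1}" for t t'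
  proof -
    have "(\<lambda>p. dist (g (fst p)) (g (snd p)) - \<bar>fst p - snd p\<bar> * K) (t, t') = 0"
    proof (rule continuous_constant_on_closure[of "range q \<times> range q"])
      show "continuous_on (closure (range q \<times> range q)) (\<lambda>p. dist (g (fst p)) (g (snd p)) - \<bar>fst p - snd p\<bar> * K)"
        unfolding closure_Times q(1)
        by (intro continuous_intros continuous_on_compose2[OF g(1)]) auto
    qed (use that q(1) g(2) xK in \<open>auto simp: closure_Times\<close>)
    then show ?thesis by simp
  qed
  then have "restrict g {0..1} \<in> geodesics"
    using g(2)[of i0] g(2)[of i1] q unfolding geodesics_def by (simp add: K_def)
  moreover have "restrict g {0..1} (q n) = x n" for n
    using g(2) subsetD[OF closure_subset, of "q n" "range q"] q(1) by auto
  ultimately show ?thesis using that by blast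
qed

text \<open>In fact \<open>F\<close> is continuous into the uniform metric: all geodesics share the
  Lipschitz constant \<open>D\<close>, so closeness at finitely many well-spread times controls the
  supremum over all times.\<close>

lemma geodesic_field_measurable:
  fixes q :: "nat \<Rightarrow> real" and F :: "real \<Rightarrow> real \<Rightarrow> 'a::metric_space"
  assumes compact: "compact (UNIV :: 'a set)"
    and q: "closure (range q) = {0..1}"
    and F: "\<And>c. c \<in> G \<Longrightarrow> F c \<in> geodesics" "\<And>n. continuous_on G (\<lambda>c. F c (q n))"
  shows "F \<in> measurable (restrict_space borel G) geodesic_borel"
proof -
  obtain D0 where D0: "\<And>x y :: 'a. dist x y \<le> D0"
    using compact_imp_bounded[OF compact] unfolding bounded_two_points by auto
  define D where "D = max D0 1"
  have D: "dist x y \<le> D" "D > 0" for x y :: 'a using D0[of x y] by (auto simp: D_def)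
  have q01: "q n \<in> {0..1}" for n using q subsetD[OF closure_subset, of "q n" "range q"] by auto
  have lip: "dist (\<gamma> t) (\<gamma> t') \<le> \<bar>t - t'\<bar> * D" if "\<gamma> \<in> geodesics" "t \<in> {0..1}" "t' \<in> {0..1}" for \<gamma> :: "real \<Rightarrow> 'a" and t t'
  proof -
    have "dist (\<gamma> t) (\<gamma> t') = \<bar>t - t'\<bar> * dist (\<gamma> 0) (\<gamma> 1)" using that unfolding geodesics_def by blast
    also have "\<dots> \<le> \<bar>t - t'\<bar> * D" by (intro mult_left_mono D) auto
    finally show ?thesis .
  qed
  have near: "\<exists>\<delta>>0. \<forall>c'\<in>G. dist c' c < \<delta> \<longrightarrow> mdist geodesic_metric (F c) (F c') \<le> r" if c: "c \<in> G" and r: "r > 0" for c r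
  proof -
    \<comment> \<open>Moving to a net time, comparing there and moving back costs \<eta>D + \<eta> +
      \<eta>D, which is to equal r.\<close>
    define \<eta> where "\<eta> = r / (1 + 2 * D)"
    have \<eta>: "\<eta> > 0" using D(2) r by (simp add: \<eta>_def)
    obtain J where J: "finite J" "\<And>t. t \<in> {0..1} \<Longrightarrow> \<exists>n\<in>J. dist (q n) t < \<eta>"
      using dense_in_unit_interval_finite_net[OF q \<eta>] by blast
    have "\<exists>\<delta>>0. \<forall>c'\<in>G. dist c' c < \<delta> \<longrightarrow> dist (F c' (q n)) (F c (q n)) < \<eta>" for n
      using F(2)[of n] c \<eta> unfolding continuous_on_iff by blast
    then obtain \<delta> where \<delta>: "\<And>n. \<delta> n > 0" "\<And>n c'. c' \<in> G \<Longrightarrow> dist c' c < \<delta> n \<Longrightarrow> dist (F c' (q n)) (F c (q n)) < \<eta>"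
      by metis
    define d where "d = Min (insert 1 (\<delta> ` J))"
    have d: "d > 0" "\<And>n. n \<in> J \<Longrightarrow> d \<le> \<delta> n" using J(1) \<delta>(1) by (auto simp: d_def)
    have "mdist geodesic_metric (F c) (F c') \<le> r" if c': "c' \<in> G" "dist c' c < d" for c'
    proof -
      let ?C = "cfunspace (top_of_set {0..1}) (euclidean_metric :: 'a metric)"
      have "F c \<in> mspace ?C" "F c' \<in> mspace ?C"
        using F(1) c c' mspace_geodesic_metric unfolding geodesic_metric_def mspace_submetric by blast+
      moreover have "dist (F c t) (F c' t) \<le> r" if t: "t \<in> {0..1}" for t
      proof -
        obtain n where n: "n \<in> J" "dist (q n) t < \<eta>" using J(2) t by blast
        have t\<eta>: "\<bar>t - q n\<bar> * D \<le> \<eta> * D" "\<bar>q n - t\<bar> * D \<le> \<eta> * D"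
          using n(2) D(2) by (auto intro!: mult_right_mono simp: dist_real_def abs_minus_commute)
        have "dist (F c t) (F c (q n)) \<le> \<eta> * D" "dist (F c' (q n)) (F c' t) \<le> \<eta> * D"
          using order_trans[OF lip[OF F(1)[OF c] t q01[of n]] t\<eta>(1)]
            order_trans[OF lip[OF F(1)[OF c'(1)] q01[of n] t] t\<eta>(2)] .
        moreover have "dist (F c' (q n)) (F c (q n)) < \<eta>"
          using \<delta>(2)[OF c'(1), of n] c'(2) d(2)[OF n(1)] by linarith
        ultimately have "dist (F c t) (F c' t) \<le> \<eta> * D + \<eta> + \<eta> * D"
          using dist_triangle[of "F c t" "F c' t" "F c (q n)"]
            dist_triangle3[of "F c (q n)" "F c' t" "F c' (q n)"] by linarith
        also have "\<dots> = \<eta> * (1 + 2 * D)" by (simp add: algebra_simps)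
        also have "\<dots> = r" using D(2) by (simp add: \<eta>_def)
        finally show ?thesis .
      qed
      ultimately have "mdist ?C (F c) (F c') \<le> r"
        by (subst cfunspace_mdist_le) (simp_all del: mspace_cfunspace)
      then show ?thesis by (simp add: geodesic_metric_def)
    qed
    then show ?thesis using d(1) by blast
  qed
  interpret GM: Metric_space "mspace (geodesic_metric :: (real \<Rightarrow> 'a) metric)" "mdist geodesic_metric"
    by (rule Metric_space_mspace_mdist)
  have "F -` U \<inter> G \<in> sets (restrict_space borel G)" if "openin (mtopology_of geodesic_metric) U" for U
  proof -
    have U: "\<And>\<gamma>. \<gamma> \<in> U \<Longrightarrow> \<exists>r>0. GM.mball \<gamma> r \<subseteq> U"
      using that unfolding mtopology_of_def GM.openin_mtopology by blast
    have "openin (top_of_set G) (F -` U \<inter> G)"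
      unfolding openin_euclidean_subtopology_iff
    proof (intro conjI ballI)
      fix c assume c: "c \<in> F -` U \<inter> G"
      then obtain r where r: "r > 0" "GM.mball (F c) r \<subseteq> U" using U by blast
      obtain \<delta> where \<delta>: "\<delta> > 0" "\<And>c'. c' \<in> G \<Longrightarrow> dist c' c < \<delta> \<Longrightarrow> mdist geodesic_metric (F c) (F c') \<le> r / 2"
        using near[of c "r/2"] c r(1) by auto
      have "F c' \<in> U" if "c' \<in> G" "dist c' c < \<delta>" for c'
      proof (rule subsetD[OF r(2)])
        have "mdist geodesic_metric (F c) (F c') < r" using \<delta>(2)[OF that] r(1) by linarith
        then show "F c' \<in> GM.mball (F c) r"
          by (subst GM.in_mball) (use F(1)[of c] F(1)[OF that(1)] c in \<open>simp add: mspace_geodesic_metric\<close>)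
      qed
      then show "\<exists>e>0. \<forall>x'\<in>G. dist x' c < e \<longrightarrow> x' \<in> F -` U \<inter> G" using \<delta>(1) by blast
    qed simp
    then obtain T where "open T" "F -` U \<inter> G = G \<inter> T" by (auto simp: openin_open)
    then show ?thesis by (auto simp: sets_restrict_space)
  qed
  then show ?thesis
    unfolding geodesic_borel_def
    by (intro measurable_measure_of)
      (use F(1) openin_subset in \<open>fastforce simp: mspace_geodesic_metric space_restrict_space\<close>)+
qed

text \<open>The last property says that a dyadic time, once on a grid, stays on all finer ones.
  Every fixed time is therefore sampled exactly by all sufficiently fine chains.\<close>

lemma dyadic_sequence:
  obtains q :: "nat \<Rightarrow> real" and i0 i1 where "closure (range q) = {0..1}" "q i0 = 0" "q i1 = 1"
    "\<And>n. \<forall>\<^sub>F k in sequentially. \<exists>i\<le>2^k. q n = real i / 2^k"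
proof -
  define D where "D = (\<Union>k::nat. (\<lambda>i. real i / 2^k) ` {..2^k})"
  have D: "countable D" by (auto simp: D_def)
  have D0: "0 \<in> D" unfolding D_def by (intro UN_I[of 0] image_eqI[of _ _ 0]) auto
  have D1: "1 \<in> D" unfolding D_def by (intro UN_I[of 0] image_eqI[of _ _ 1]) auto
  define q where "q = from_nat_into D"
  have q: "range q = D" unfolding q_def by (rule range_from_nat_into) (use D D0 in auto)
  have "D \<subseteq> {0..1}" by (auto simp: D_def field_simps)
  then have "closure D \<subseteq> {0..1}" by (simp add: closure_minimal)
  moreover have "t \<in> closure D" if t: "t \<in> {0..1}" for t :: real
    unfolding closure_approachable
  proof (intro allI impI)
    fix e :: real assume "e > 0"
    then obtain k where k: "(1/2) ^ k < e" using real_arch_pow_inv[of e "1/2"] by auto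
    define i where "i = nat \<lfloor>t * 2^k\<rfloor>"
    have i: "real i \<le> t * 2^k" "t * 2^k < real i + 1"
      using t by (auto simp: i_def)
    have "t * 2^k \<le> 1 * 2^k" using t by (intro mult_right_mono) auto
    from order_trans[OF i(1) this] have "i \<le> 2^k" by simp
    then have "real i / 2^k \<in> D" unfolding D_def by blast
    moreover have "t < (real i + 1) / 2^k" "real i / 2^k \<le> t"
      using i by (simp_all add: pos_less_divide_eq pos_divide_le_eq)
    then have "dist (real i / 2^k) t < e" using k by (simp add: dist_real_def power_one_over abs_minus_commute add_divide_distrib)
    ultimately show "\<exists>y\<in>D. dist y t < e" by blast
  qed
  ultimately have "closure (range q) = {0..1}" using q by auto
  moreover obtain i0 i1 where "q i0 = 0" "q i1 = 1" using D0 D1 q by (metis imageE)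
  moreover have "\<forall>\<^sub>F k in sequentially. \<exists>i\<le>2^k. q n = real i / 2^k" for n
  proof -
    have "q n \<in> D" using q by auto
    then obtain k0 i where ki: "i \<le> 2^k0" "q n = real i / 2^k0" by (auto simp: D_def)
    have "\<exists>j\<le>2^k. q n = real j / 2^k" if k: "k \<ge> k0" for k
    proof (intro exI[of _ "i * 2^(k - k0)"] conjI)
      have e: "(2::'b::comm_semiring_1)^k = 2^k0 * 2^(k - k0)" using k by (simp flip: power_add)
      show "i * 2^(k - k0) \<le> 2^k" using ki(1) by (simp add: e)
      show "q n = real (i * 2^(k - k0)) / 2^k" by (simp add: e ki(2))
    qed
    then show ?thesis by (auto simp: eventually_sequentially)
  qed
  ultimately show ?thesis using that by blast
qed

section \<open>Restriction to full measure, and almost sure equality forced by second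
  moments\<close>

lemma distr_restrict_space_AE:
  assumes f: "f \<in> measurable M N" and G: "G \<in> sets M" "AE x in M. x \<in> G"
  shows "distr (restrict_space M G) N f = distr M N f"
proof (rule measure_eqI)
  fix A assume "A \<in> sets (distr (restrict_space M G) N f)"
  then have A: "A \<in> sets N" by simp
  have f': "f \<in> measurable (restrict_space M G) N" using f by (rule measurable_restrict_space1)
  have Gs: "G \<subseteq> space M" using G(1) by (rule sets.sets_into_space)
  have "emeasure (distr (restrict_space M G) N f) A = emeasure M (f -` A \<inter> G)"
    using A G(1) Gs sets.Int_space_eq2[OF G(1)] by (subst emeasure_distr[OF f' A])
      (simp add: space_restrict_space emeasure_restrict_space Int_absorb2)
  also have "f -` A \<inter> G = (f -` A \<inter> space M) \<inter> G" using Gs by auto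
  also have "emeasure M \<dots> = emeasure M (f -` A \<inter> space M)"
  proof (rule emeasure_eq_AE)
    show "AE x in M. x \<in> f -` A \<inter> space M \<inter> G \<longleftrightarrow> x \<in> f -` A \<inter> space M"
      using G(2) by eventually_elim simp
  qed (use sets.Int[OF measurable_sets[OF f A] G(1)] measurable_sets[OF f A] in blast)+
  also have "\<dots> = emeasure (distr M N f) A" using A f by (simp add: emeasure_distr)
  finally show "emeasure (distr (restrict_space M G) N f) A = emeasure (distr M N f) A" .
qed simp

text \<open>The lower bound on b makes b^2 - u^2 T^2 nonnegative, and the moment bounds make its
  mean at most u^2 V - u^2 V = 0.\<close>

lemma (in prob_space) AE_eq_of_second_moments:
  fixes b T :: "'a \<Rightarrow> real"
  assumes int: "integrable M (\<lambda>x. (b x)\<^sup>2)" "integrable M (\<lambda>x. (T x)\<^sup>2)"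
    and T: "\<And>x. T x \<ge> 0" "u \<ge> 0" and b: "AE x in M. u * T x \<le> b x"
    and V: "expectation (\<lambda>x. (b x)\<^sup>2) \<le> u\<^sup>2 * V" "V \<le> expectation (\<lambda>x. (T x)\<^sup>2)"
  shows "AE x in M. b x = u * T x"
proof -
  have i: "integrable M (\<lambda>x. (b x)\<^sup>2 - u\<^sup>2 * (T x)\<^sup>2)" using int by simp
  have nn: "AE x in M. 0 \<le> (b x)\<^sup>2 - u\<^sup>2 * (T x)\<^sup>2"
    using b by eventually_elim (use power_mono[of "u * T _" _ 2] T in \<open>auto simp: power_mult_distrib\<close>)
  have "expectation (\<lambda>x. (b x)\<^sup>2 - u\<^sup>2 * (T x)\<^sup>2) \<le> 0"
    using int V(1) mult_left_mono[OF V(2), of "u\<^sup>2"] by simp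
  then have "expectation (\<lambda>x. (b x)\<^sup>2 - u\<^sup>2 * (T x)\<^sup>2) = 0"
    using integral_nonneg_AE[OF nn] by linarith
  then have "AE x in M. (b x)\<^sup>2 - u\<^sup>2 * (T x)\<^sup>2 = 0"
    using integral_nonneg_eq_0_iff_AE[OF i nn] by simp
  then show ?thesis using b
  proof eventually_elim
    case (elim x)
    then have "(b x)\<^sup>2 = (u * T x)\<^sup>2" by (simp add: power_mult_distrib)
    moreover have "0 \<le> u * T x" "0 \<le> b x" using mult_nonneg_nonneg[OF T(2) T(1)[of x]] elim(2) by linarith+
    ultimately show ?case by (simp add: power2_eq_iff_nonneg)
  qed
qed

text \<open>The gap in the Cauchy-Schwarz inequality for \<open>a + c\<close> with weights \<open>s\<close> and \<open>1 - s\<close>.\<close>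

lemma convexity_gap:
  fixes a c s :: real
  assumes "0 < s" "s < 1"
  shows "a\<^sup>2 / s + c\<^sup>2 / (1 - s) = (a + c)\<^sup>2 + ((1 - s) * a - s * c)\<^sup>2 / (s * (1 - s))"
proof -
  \<comment> \<open>A name for 1 - s keeps the denominator atomic while fractions are
    cleared.\<close>
  define r where "r = 1 - s"
  have r: "r > 0" "s = 1 - r" using assms by (auto simp: r_def)
  show ?thesis unfolding r_def[symmetric]
    using assms r(1) by (simp add: field_simps power2_eq_square) (simp add: r(2) algebra_simps)
qed

text \<open>The mean of a^2/s + c^2/(1-s) - T^2 is at most sV + (1-s)V - V = 0. By
  \<open>convexity_gap\<close> the integrand is a sum of two nonnegative terms, so both vanish
  almost surely: one gives a + c = T (equality in the triangle inequality), the other (1-s)a = sc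
  (equality in Cauchy-Schwarz).\<close>

lemma (in prob_space) AE_split_of_second_moments:
  fixes a c T :: "'a \<Rightarrow> real"
  assumes s: "0 < s" "s < 1"
    and int: "integrable M (\<lambda>x. (a x)\<^sup>2)" "integrable M (\<lambda>x. (c x)\<^sup>2)" "integrable M (\<lambda>x. (T x)\<^sup>2)"
    and T: "\<And>x. T x \<ge> 0" "\<And>x. T x \<le> a x + c x"
    and V: "expectation (\<lambda>x. (a x)\<^sup>2) \<le> s\<^sup>2 * V" "expectation (\<lambda>x. (c x)\<^sup>2) \<le> (1 - s)\<^sup>2 * V"
      "V \<le> expectation (\<lambda>x. (T x)\<^sup>2)"
  shows "AE x in M. a x = s * T x"
proof -
  let ?X = "\<lambda>x. (a x)\<^sup>2 / s + (c x)\<^sup>2 / (1 - s) - (T x)\<^sup>2"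
  have i: "integrable M ?X" using int by simp
  have gap: "?X x = ((a x + c x)\<^sup>2 - (T x)\<^sup>2) + ((1 - s) * a x - s * c x)\<^sup>2 / (s * (1 - s))" for x
    using convexity_gap[OF s, of "a x" "c x"] by simp
  have nn1: "0 \<le> (a x + c x)\<^sup>2 - (T x)\<^sup>2" for x
    using power_mono[OF T(2)[of x] T(1)[of x], of 2] by simp
  have nn2: "0 \<le> ((1 - s) * a x - s * c x)\<^sup>2 / (s * (1 - s))" for x using s by simp
  have nn: "AE x in M. 0 \<le> ?X x" unfolding gap using nn1 nn2 by (simp add: add_nonneg_nonneg)
  have "expectation ?X = expectation (\<lambda>x. (a x)\<^sup>2) / s + expectation (\<lambda>x. (c x)\<^sup>2) / (1 - s) - expectation (\<lambda>x. (T x)\<^sup>2)"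
    using int by simp
  also have "\<dots> \<le> (s\<^sup>2 * V) / s + ((1 - s)\<^sup>2 * V) / (1 - s) - V"
    using s V by (intro diff_mono add_mono divide_right_mono) auto
  also have "\<dots> = s * V + (1 - s) * V - V" using s by (simp add: power2_eq_square)
  also have "\<dots> = 0" by (simp add: left_diff_distrib)
  finally have "expectation ?X = 0" using integral_nonneg_AE[OF nn] by linarith
  then have "AE x in M. ?X x = 0" using integral_nonneg_eq_0_iff_AE[OF i nn] by simp
  then show ?thesis
  proof eventually_elim
    case (elim x)
    then have "(a x + c x)\<^sup>2 - (T x)\<^sup>2 = 0" "((1 - s) * a x - s * c x)\<^sup>2 / (s * (1 - s)) = 0"
      using gap[of x] nn1[of x] nn2[of x] by linarith+
    then have sum: "a x + c x = T x" and "(1 - s) * a x = s * c x"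
      using s T[of x] by (auto simp: power2_eq_iff)
    from this(2) have "a x = s * (a x + c x)" by (simp add: algebra_simps)
    with sum show ?case by metis
  qed
qed

section \<open>The limit process\<close>

text \<open>The chain with 2^k steps has errors of order 1/(k+1) in its laws and squared distances.
  These estimates involve continuous functions of at most two positions, so they become exact in the
  limit. The second-moment lemmas turn them into identities for almost every code, and
  \<open>G\<close> is the set of codes where all of them hold.\<close>

lemma geodesic_process:
  fixes \<mu> :: "real \<Rightarrow> 'a::metric_space measure"
  assumes compact: "compact (UNIV :: 'a set)" and geo: "P2_geodesic_path \<mu>"
    and q: "\<And>n. \<forall>\<^sub>F k in sequentially. \<exists>i\<le>2^k. q n = real i / 2^k" and i01: "q i0 = 0" "q i1 = 1"
  obtains G :: "real set" and M and f :: "nat \<Rightarrow> real \<Rightarrow> 'a" where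
    "prob_space M" "sets M = sets (restrict_space borel G)" "\<And>n. continuous_on G (f n)"
    "\<And>c m n. c \<in> G \<Longrightarrow> dist (f m c) (f n c) = \<bar>q m - q n\<bar> * dist (f i0 c) (f i1 c)"
    "\<And>n. distr M borel (f n) = \<mu> (q n)"
    "(\<integral>c. (dist (f i0 c) (f i1 c))\<^sup>2 \<partial>M) \<le> (W2 (\<mu> 0) (\<mu> 1))\<^sup>2"
proof -
  define W where "W = W2 (\<mu> 0) (\<mu> 1)"
  have q01: "q n \<in> {0..1}" for n
  proof -
    obtain k i where "i \<le> 2^k" "q n = real i / 2^k"
      using q[of n] by (auto simp: eventually_sequentially)
    then show ?thesis by simp
  qed
  have \<mu>: "prob_space (\<mu> t)" "sets (\<mu> t) = sets borel" if "t \<in> {0..1}" for t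
    using geo that unfolding P2_geodesic_path_def P2_iff by blast+
  obtain D where D: "\<And>x y :: 'a. dist x y \<le> D"
    using compact_imp_bounded[OF compact] unfolding bounded_two_points by auto
  have sqD: "\<bar>(dist x y)\<^sup>2\<bar> \<le> D\<^sup>2" for x y :: 'a using D by (simp add: power_mono)
  define P_spec where "P_spec k P \<longleftrightarrow>
    (\<forall>i\<le>2^k. \<forall>L g. L-lipschitz_on UNIV g \<longrightarrow> (\<forall>x. \<bar>g x\<bar> \<le> 1) \<longrightarrow>
      \<bar>(\<integral>w. g (w i) \<partial>P) - integral\<^sup>L (\<mu> (real i / 2^k)) g\<bar> \<le> L * (1 / real (Suc k))) \<and>
    (\<forall>j\<le>2^k. \<forall>i\<le>j. (\<integral>w. (dist (w i) (w j))\<^sup>2 \<partial>P) \<le> ((real j - real i) / 2^k)\<^sup>2 * (W\<^sup>2 + 1 / real (Suc k)))"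
    for k and P :: "(nat \<Rightarrow> 'a) pmf"
  have "\<exists>P. P_spec k P" for k
  proof (rule discretised_geodesic_chain[OF compact geo, of "2^k" "1 / real (Suc k)" "1 / real (Suc k)"])
    fix P :: "(nat \<Rightarrow> 'a) pmf"
    assume law: "\<And>i g L B. i \<le> 2^k \<Longrightarrow> L-lipschitz_on UNIV g \<Longrightarrow> (\<And>x. \<bar>g x\<bar> \<le> B) \<Longrightarrow>
        \<bar>(\<integral>w. g (w i) \<partial>P) - integral\<^sup>L (\<mu> (real i / real (2^k))) g\<bar> \<le> L * (1 / real (Suc k))"
      and cost: "\<And>i j. i \<le> j \<Longrightarrow> j \<le> 2^k \<Longrightarrow>
        (\<integral>w. (dist (w i) (w j))\<^sup>2 \<partial>P) \<le> (real (j - i) / real (2^k))\<^sup>2 * ((W2 (\<mu> 0) (\<mu> 1))\<^sup>2 + 1 / real (Suc k))"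
    have "P_spec k P"
      unfolding P_spec_def W_def
    proof (intro conjI allI impI)
      fix i :: nat and L :: real and g :: "'a \<Rightarrow> real" assume "i \<le> 2^k" "L-lipschitz_on UNIV g" "\<forall>x. \<bar>g x\<bar> \<le> 1"
      then show "\<bar>(\<integral>w. g (w i) \<partial>P) - integral\<^sup>L (\<mu> (real i / 2^k)) g\<bar> \<le> L * (1 / real (Suc k))"
        using law[of i L g 1] by simp
    next
      fix i j :: nat assume "j \<le> 2^k" "i \<le> j"
      then show "(\<integral>w. (dist (w i) (w j))\<^sup>2 \<partial>P) \<le> ((real j - real i) / 2^k)\<^sup>2 * ((W2 (\<mu> 0) (\<mu> 1))\<^sup>2 + 1 / real (Suc k))"
        using cost[of i j] by (simp add: of_nat_diff)
    qed
    then show ?thesis ..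
  qed simp_all
  then obtain P where P: "\<And>k. P_spec k (P k)" by metis
  \<comment> \<open>For each \<open>n\<close>, the floor is exact for all large \<open>k\<close>.\<close>
  define Q where "Q k = map_pmf (\<lambda>w n. w (nat \<lfloor>q n * 2^k\<rfloor>)) (P k)" for k
  have Qint: "(\<integral>w. h (w m, w n) \<partial>Q k) = (\<integral>w. h (w i, w j) \<partial>P k)"
    if "q m = real i / 2^k" "q n = real j / 2^k" for h :: "'a \<times> 'a \<Rightarrow> real" and m n i j k
    using that by (simp add: Q_def)
  obtain s C M0 and f :: "nat \<Rightarrow> real \<Rightarrow> 'a" where s: "strict_mono s" and C: "compact C"
    and M0: "prob_space M0" "sets M0 = sets (restrict_space borel C)" and f: "\<And>n. continuous_on C (f n)"
    and lim: "\<And>h m n. continuous_on UNIV h \<Longrightarrow>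
      (\<lambda>k. \<integral>w. h (w m, w n) \<partial>Q (s k)) \<longlonglongrightarrow> (\<integral>c. (h (f m c, f n c) :: real) \<partial>M0)"
    by (rule pmf_sequence_weak_limit[OF compact, of Q]) (rule that; assumption)
  interpret M0: prob_space M0 by (rule M0)
  have meas: "g \<in> borel_measurable M0" if "continuous_on C g" for g :: "real \<Rightarrow> 'b::topological_space"
    using borel_measurable_continuous_on_restrict[OF that] unfolding measurable_cong_sets[OF M0(2) refl] .
  note s_lim = filterlim_subseq[OF s]
  have inv: "(\<lambda>k. 1 / real (Suc (s k))) \<longlonglongrightarrow> 0"
    using LIMSEQ_subseq_LIMSEQ[OF LIMSEQ_inverse_real_of_nat s] by (simp add: comp_def inverse_eq_divide)
  have law: "distr M0 borel (f n) = \<mu> (q n)" for n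
  proof (rule measure_eqI_lipschitz)
    show "finite_measure (distr M0 borel (f n))"
      by (intro prob_space.finite_measure M0.prob_space_distr meas f)
    show "finite_measure (\<mu> (q n))" by (rule prob_space.finite_measure[OF \<mu>(1)[OF q01]])
    show "sets (\<mu> (q n)) = sets borel" by (rule \<mu>(2)[OF q01])
    fix g :: "'a \<Rightarrow> real" and L assume g: "L-lipschitz_on UNIV g" "\<And>x. \<bar>g x\<bar> \<le> 1"
    have gc: "continuous_on UNIV g" by (rule lipschitz_on_continuous_on[OF g(1)])
    have near: "\<forall>\<^sub>F k in sequentially. \<bar>(\<integral>w. g (w n) \<partial>Q (s k)) - integral\<^sup>L (\<mu> (q n)) g\<bar> \<le> L * (1 / real (Suc (s k)))"
      using eventually_compose_filterlim[OF q[of n] s_lim]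
    proof eventually_elim
      case (elim k)
      then obtain i where i: "i \<le> 2^(s k)" "q n = real i / 2^(s k)" by blast
      have "\<bar>(\<integral>w. g (w i) \<partial>P (s k)) - integral\<^sup>L (\<mu> (real i / 2^(s k))) g\<bar> \<le> L * (1 / real (Suc (s k)))"
        using P[of "s k"] i(1) g unfolding P_spec_def by blast
      then show ?case using Qint[OF i(2) i(2), of "\<lambda>p. g (fst p)"] i(2) by simp
    qed
    have "(\<lambda>k. L * (1 / real (Suc (s k)))) \<longlonglongrightarrow> 0"
      using tendsto_mult_left[OF inv, of L] by simp
    from Lim_null_comparison[OF near[folded real_norm_def] this]
    have "(\<lambda>k. (\<integral>w. g (w n) \<partial>Q (s k)) - integral\<^sup>L (\<mu> (q n)) g) \<longlonglongrightarrow> 0"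
      .
    then have "(\<lambda>k. \<integral>w. g (w n) \<partial>Q (s k)) \<longlonglongrightarrow> integral\<^sup>L (\<mu> (q n)) g"
      by (simp add: LIM_zero_iff)
    moreover have "continuous_on UNIV (\<lambda>p :: 'a \<times> 'a. g (fst p))"
      by (intro continuous_on_compose2[OF gc] continuous_intros) auto
    from lim[OF this, of n n] have "(\<lambda>k. \<integral>w. g (w n) \<partial>Q (s k)) \<longlonglongrightarrow> (\<integral>c. g (f n c) \<partial>M0)"
      by simp
    ultimately have "(\<integral>c. g (f n c) \<partial>M0) = integral\<^sup>L (\<mu> (q n)) g" by (rule LIMSEQ_unique[rotated])
    then show "integral\<^sup>L (distr M0 borel (f n)) g = integral\<^sup>L (\<mu> (q n)) g"
      by (subst integral_distr[OF meas[OF f] borel_measurable_continuous_onI[OF gc]])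
  qed simp
  have cost: "(\<integral>c. (dist (f m c) (f n c))\<^sup>2 \<partial>M0) \<le> (q m - q n)\<^sup>2 * W\<^sup>2" for m n
  proof (rule tendsto_le)
    show "(\<lambda>k. \<integral>w. (dist (w m) (w n))\<^sup>2 \<partial>Q (s k)) \<longlonglongrightarrow> (\<integral>c. (dist (f m c) (f n c))\<^sup>2 \<partial>M0)"
    proof -
      have "continuous_on UNIV (\<lambda>p :: 'a \<times> 'a. (dist (fst p) (snd p))\<^sup>2)" by (intro continuous_intros)
      from lim[OF this, of m n] show ?thesis by simp
    qed
    have "(\<lambda>k. (q m - q n)\<^sup>2 * (W\<^sup>2 + 1 / real (Suc (s k)))) \<longlonglongrightarrow> (q m - q n)\<^sup>2 * (W\<^sup>2 + 0)"
      by (intro tendsto_intros inv)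
    then show "(\<lambda>k. (q m - q n)\<^sup>2 * (W\<^sup>2 + 1 / real (Suc (s k)))) \<longlonglongrightarrow> (q m - q n)\<^sup>2 * W\<^sup>2" by simp
    show "\<forall>\<^sub>F k in sequentially. (\<integral>w. (dist (w m) (w n))\<^sup>2 \<partial>Q (s k)) \<le> (q m - q n)\<^sup>2 * (W\<^sup>2 + 1 / real (Suc (s k)))"
      using eventually_compose_filterlim[OF q[of m] s_lim] eventually_compose_filterlim[OF q[of n] s_lim]
    proof eventually_elim
      case (elim k)
      then obtain i j where i: "i \<le> 2^(s k)" "q m = real i / 2^(s k)" and j: "j \<le> 2^(s k)" "q n = real j / 2^(s k)" by blast
      have "(\<integral>w. (dist (w m) (w n))\<^sup>2 \<partial>Q (s k)) = (\<integral>w. (dist (w i) (w j))\<^sup>2 \<partial>P (s k))"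
        using Qint[OF i(2) j(2), of "\<lambda>p. (dist (fst p) (snd p))\<^sup>2"] by simp
      also have "\<dots> \<le> ((real j - real i) / 2^(s k))\<^sup>2 * (W\<^sup>2 + 1 / real (Suc (s k)))"
      proof (cases "i \<le> j")
        case True
        then show ?thesis using P[of "s k"] j(1) unfolding P_spec_def by blast
      next
        case False
        then have "(\<integral>w. (dist (w j) (w i))\<^sup>2 \<partial>P (s k)) \<le> ((real i - real j) / 2^(s k))\<^sup>2 * (W\<^sup>2 + 1 / real (Suc (s k)))"
          using P[of "s k"] i(1) unfolding P_spec_def by (meson nle_le)
        also have "((real i - real j) / 2^(s k))\<^sup>2 = ((real j - real i) / 2^(s k))\<^sup>2"
          by (simp add: power_divide power2_commute)
        finally show ?thesis by (simp add: dist_commute)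
      qed
      also have "((real j - real i) / 2^(s k))\<^sup>2 = (q m - q n)\<^sup>2"
        by (simp add: i(2) j(2) power2_commute[of "q m"] diff_divide_distrib power2_commute)
      finally show ?case .
    qed
  qed simp
  have cont_dist: "continuous_on C (\<lambda>c. dist (f m c) (f n c))" for m n by (intro continuous_intros f)
  have int: "integrable M0 (\<lambda>c. (dist (f m c) (f n c))\<^sup>2)" for m n
    by (rule M0.integrable_const_bound[of _ "D\<^sup>2"])
      (use sqD in \<open>auto intro!: meas continuous_on_power cont_dist\<close>)
  let ?T = "\<lambda>c. dist (f i0 c) (f i1 c)"
  \<comment> \<open>The reverse bound that creates rigidity: the limiting joint law of the endpoints
    is itself a plan between the end measures.\<close>
  have WT: "W\<^sup>2 \<le> (\<integral>c. (?T c)\<^sup>2 \<partial>M0)"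
  proof -
    define e where "e c = (f i0 c, f i1 c)" for c
    have e: "e \<in> borel_measurable M0" unfolding e_def[abs_def] by (intro meas continuous_on_Pair f)
    note pr = borel_measurable_fst_snd
    have "distr M0 borel e \<in> transference_plans (\<mu> 0) (\<mu> 1)"
      using M0.prob_space_distr[OF e] law[of i0] law[of i1] i01
      by (simp add: transference_plans_def space_prob_algebra distr_distr[OF pr(1) e] distr_distr[OF pr(2) e] comp_def e_def)
    from W2_le_integral[OF D this] have "W\<^sup>2 \<le> (\<integral>(x, y). (dist x y)\<^sup>2 \<partial>distr M0 borel e)" by (simp add: W_def)
    also have "\<dots> = (\<integral>c. (?T c)\<^sup>2 \<partial>M0)"
    proof -
      have "continuous_on UNIV (\<lambda>p :: 'a \<times> 'a. (dist (fst p) (snd p))\<^sup>2)" by (intro continuous_intros)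
      from integral_distr[OF e borel_measurable_continuous_onI[OF this]]
      show ?thesis by (simp add: case_prod_unfold e_def)
    qed
    finally show ?thesis .
  qed
  \<comment> \<open>The splitting argument divides by s and 1 - s, so times 0 and 1 are treated
    through this case.\<close>
  have zero: "AE c in M0. f m c = f n c" if "q m = q n" for m n
  proof -
    have "(\<integral>c. (dist (f m c) (f n c))\<^sup>2 \<partial>M0) = 0"
      using cost[of m n] that by (intro antisym Bochner_Integration.integral_nonneg) auto
    then have "AE c in M0. (dist (f m c) (f n c))\<^sup>2 = 0"
      using integral_nonneg_eq_0_iff_AE[OF int, of m n] by simp
    then show ?thesis by eventually_elim simp
  qed
  have start: "AE c in M0. dist (f i0 c) (f m c) = q m * ?T c" for m
  proof -
    consider "q m = 0" | "q m = 1" | "0 < q m" "q m < 1" using q01[of m] by fastforce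
    then show ?thesis
    proof cases
      case 1
      have "AE c in M0. f m c = f i0 c" using 1 i01 by (intro zero) simp
      then show ?thesis by eventually_elim (simp add: 1)
    next
      case 2
      have "AE c in M0. f m c = f i1 c" using 2 i01 by (intro zero) simp
      then show ?thesis by eventually_elim (simp add: 2)
    next
      case 3
      show ?thesis
      proof (rule M0.AE_split_of_second_moments[where a = "\<lambda>c. dist (f i0 c) (f m c)"
            and c = "\<lambda>c. dist (f m c) (f i1 c)" and T = ?T and V = "W\<^sup>2", OF 3 int int int])
        show "?T c \<le> dist (f i0 c) (f m c) + dist (f m c) (f i1 c)" for c by (rule dist_triangle)
      qed (use cost[of i0 m] cost[of m i1] WT i01 in \<open>simp_all add: power2_commute\<close>)
    qed
  qed
  have ordered: "AE c in M0. dist (f m c) (f n c) = (q n - q m) * ?T c" if "q m \<le> q n" for m n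
  proof (rule M0.AE_eq_of_second_moments[where b = "\<lambda>c. dist (f m c) (f n c)" and T = ?T
        and V = "W\<^sup>2", OF int int])
    \<comment> \<open>The identities from time 0 and the triangle inequality bound the distance from
      below; \<open>cost\<close> bounds its second moment from above.\<close>
    show "AE c in M0. (q n - q m) * ?T c \<le> dist (f m c) (f n c)"
      using start[of m] start[of n]
    proof eventually_elim
      case (elim c)
      then show ?case using dist_triangle[of "f i0 c" "f n c" "f m c"] by (simp add: left_diff_distrib)
    qed
  qed (use that cost[of m n] WT in \<open>simp_all add: power2_commute\<close>)
  have all: "AE c in M0. dist (f m c) (f n c) = \<bar>q m - q n\<bar> * ?T c" for m n
  proof (cases "q m \<le> q n")
    case True
    then show ?thesis using ordered[of m n] by simp
  next
    case False
    then show ?thesis using ordered[of n m] by (simp add: dist_commute)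
  qed
  \<comment> \<open>Countably many equations between continuous functions on the closed set
    \<open>C\<close>, so \<open>G\<close> is closed and hence Borel.\<close>
  define G where "G = {c \<in> C. \<forall>m n. dist (f m c) (f n c) - \<bar>q m - q n\<bar> * ?T c = 0}"
  have "G = (\<Inter>m. \<Inter>n. {c \<in> C. dist (f m c) (f n c) - \<bar>q m - q n\<bar> * ?T c = 0})" by (auto simp: G_def)
  moreover have "closed (\<Inter>m. \<Inter>n. {c \<in> C. dist (f m c) (f n c) - \<bar>q m - q n\<bar> * ?T c = 0})"
    by (intro closed_INT ballI continuous_closed_preimage_constant continuous_intros f compact_imp_closed[OF C])
  ultimately have Gcl: "closed G" by simp
  have GC: "G \<subseteq> C" by (auto simp: G_def)
  have GM: "G \<in> sets M0" using Gcl GC unfolding M0(2) by (auto simp: sets_restrict_space image_iff intro!: bexI[of _ G])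
  have space: "space M0 = C" using sets_eq_imp_space_eq[OF M0(2)] by (simp add: space_restrict_space)
  have "AE c in M0. \<forall>m n. dist (f m c) (f n c) = \<bar>q m - q n\<bar> * ?T c"
    unfolding AE_all_countable by (intro allI all)
  then have AEG: "AE c in M0. c \<in> G"
    using AE_space
  proof eventually_elim
    case (elim c)
    then show ?case unfolding G_def space right_minus_eq by blast
  qed
  define M where "M = restrict_space M0 G"
  have M_distr: "distr M borel g = distr M0 borel g" if "g \<in> borel_measurable M0" for g :: "real \<Rightarrow> 'b::topological_space"
    unfolding M_def by (rule distr_restrict_space_AE[OF that GM AEG])
  show ?thesis
  proof
    show "prob_space M" unfolding M_def
      using AEG GM by (intro prob_space_restrict_space M0.emeasure_eq_1_AE) auto
    have "sets M = sets (restrict_space (restrict_space borel C) G)"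
      unfolding M_def by (rule sets_restrict_space_cong[OF M0(2)])
    also have "\<dots> = sets (restrict_space borel G)"
      using GC by (simp add: sets_restrict_restrict_space Int_absorb1)
    finally show "sets M = sets (restrict_space borel G)" .
    show "continuous_on G (f n)" for n by (rule continuous_on_subset[OF f GC])
    show "dist (f m c) (f n c) = \<bar>q m - q n\<bar> * dist (f i0 c) (f i1 c)" if "c \<in> G" for c m n
      using that unfolding G_def right_minus_eq by blast
    show "distr M borel (f n) = \<mu> (q n)" for n using M_distr[OF meas[OF f]] law by simp
    have T2: "(\<lambda>c. (?T c)\<^sup>2) \<in> borel_measurable M0" by (intro meas continuous_intros f)
    \<comment> \<open>Both integrals are the mean of the law of the squared distance, and that law
      is the same under \<open>M\<close> and \<open>M0\<close>.\<close>
    have "(\<integral>c. (?T c)\<^sup>2 \<partial>M) = (\<integral>c. (?T c)\<^sup>2 \<partial>M0)"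
      using integral_distr[OF T2, of "\<lambda>x. x"] integral_distr[OF measurable_restrict_space1[OF T2, of G], of "\<lambda>x. x"] M_distr[OF T2]
      by (simp add: M_def)
    then show "(\<integral>c. (?T c)\<^sup>2 \<partial>M) \<le> (W2 (\<mu> 0) (\<mu> 1))\<^sup>2"
      using cost[of i0 i1] i01 by (simp add: W_def)
  qed
qed

theorem proposition2p10:
  fixes \<mu> :: "real \<Rightarrow> 'a::metric_space measure"
  assumes "compact (UNIV :: 'a set)"
    and "length_space TYPE('a)"
    and "P2_geodesic_path \<mu>"
  shows "\<exists>\<pi> \<Theta>. optimal_dynamical_transference_plan \<pi> \<Theta> \<and>
    (\<forall>t \<in> {0..1}. \<mu> t = displacement_interpolation \<Theta> t)"
proof -
  note compact = assms(1) and geo = assms(3)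
  obtain q :: "nat \<Rightarrow> real" and i0 i1 where q: "closure (range q) = {0..1}" "q i0 = 0" "q i1 = 1"
    "\<And>n. \<forall>\<^sub>F k in sequentially. \<exists>i\<le>2^k. q n = real i / 2^k"
    by (rule dyadic_sequence) (rule that; assumption)
  have q01: "q n \<in> {0..1}" for n using q(1) subsetD[OF closure_subset, of "q n" "range q"] by auto
  obtain G :: "real set" and M and f :: "nat \<Rightarrow> real \<Rightarrow> 'a" where
    M: "prob_space M" "sets M = sets (restrict_space borel G)" and f: "\<And>n. continuous_on G (f n)"
    and dist_f: "\<And>c m n. c \<in> G \<Longrightarrow> dist (f m c) (f n c) = \<bar>q m - q n\<bar> * dist (f i0 c) (f i1 c)"
    and law: "\<And>n. distr M borel (f n) = \<mu> (q n)"
    and cost: "(\<integral>c. (dist (f i0 c) (f i1 c))\<^sup>2 \<partial>M) \<le> (W2 (\<mu> 0) (\<mu> 1))\<^sup>2"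
    by (rule geodesic_process[OF compact geo q(4,2,3)]) (rule that; assumption)
  interpret M: prob_space M by (rule M)
  have space: "space M = G" using sets_eq_imp_space_eq[OF M(2)] by (simp add: space_restrict_space)
  have geo2: "W2 (\<mu> t) (\<mu> t') = \<bar>t - t'\<bar> * W2 (\<mu> 0) (\<mu> 1)" and P2: "\<mu> t \<in> P2"
    if "t \<in> {0..1}" "t' \<in> {0..1}" for t t'
    using geo that unfolding P2_geodesic_path_def by blast+
  obtain D where D: "\<And>x y :: 'a. dist x y \<le> D"
    using compact_imp_bounded[OF compact] unfolding bounded_two_points by auto
  \<comment> \<open>The choice is made code by code without regard to measurability, which follows
    afterwards from continuity at the times \<open>q n\<close>.\<close>
  have "\<exists>\<gamma>. \<gamma> \<in> geodesics \<and> (\<forall>n. \<gamma> (q n) = f n c)" if "c \<in> G" for c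
    using geodesic_extension[OF compact q(1,2,3), of "\<lambda>n. f n c"] dist_f[OF that] by metis
  then obtain F where F: "\<And>c. c \<in> G \<Longrightarrow> F c \<in> geodesics" "\<And>c n. c \<in> G \<Longrightarrow> F c (q n) = f n c"
    by metis
  have "continuous_on G (\<lambda>c. F c (q n))" for n
    using f[of n] by (rule continuous_on_eq) (simp add: F(2))
  from geodesic_field_measurable[OF compact q(1) F(1) this]
  have Fm: "F \<in> measurable M geodesic_borel" unfolding measurable_cong_sets[OF M(2) refl] .
  have f_meas: "f n \<in> borel_measurable M" for n
    using borel_measurable_continuous_on_restrict[OF f] unfolding measurable_cong_sets[OF M(2) refl] .
  define \<Theta> where "\<Theta> = distr M geodesic_borel F"
  interpret \<Theta>: prob_space \<Theta> unfolding \<Theta>_def by (rule M.prob_space_distr[OF Fm])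
  define \<pi> where "\<pi> = distr \<Theta> borel geodesic_endpoints"
  have end_meas: "(geodesic_endpoints :: (real \<Rightarrow> 'a) \<Rightarrow> _) \<in> borel_measurable \<Theta>"
    unfolding \<Theta>_def using measurable_geodesic_endpoints by simp
  note pr = borel_measurable_fst_snd
  have eval: "distr \<Theta> borel (geodesic_eval t) = distr M borel (\<lambda>c. F c t)" if "t \<in> {0..1}" for t
    unfolding \<Theta>_def by (subst distr_distr[OF measurable_geodesic_eval[OF that] Fm]) (simp add: comp_def geodesic_eval_def)
  have eval_q: "distr \<Theta> borel (geodesic_eval (q n)) = \<mu> (q n)" for n
    unfolding eval[OF q01] law[symmetric] by (rule distr_cong) (simp_all add: space F(2))
  have \<pi>_fst: "distr \<pi> borel fst = \<mu> 0"
    using eval_q[of i0] unfolding \<pi>_def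
    by (subst distr_distr[OF pr(1) end_meas]) (simp add: comp_def geodesic_endpoints_def geodesic_eval_def[abs_def] q(2))
  have \<pi>_snd: "distr \<pi> borel snd = \<mu> 1"
    using eval_q[of i1] unfolding \<pi>_def
    by (subst distr_distr[OF pr(2) end_meas]) (simp add: comp_def geodesic_endpoints_def geodesic_eval_def[abs_def] q(3))
  have plan: "\<pi> \<in> transference_plans (\<mu> 0) (\<mu> 1)"
    using \<Theta>.prob_space_distr[OF end_meas] \<pi>_fst \<pi>_snd
    by (simp add: transference_plans_def space_prob_algebra \<pi>_def)
  have "optimal_transference_plan (\<mu> 0) (\<mu> 1) \<pi>"
  \<comment> \<open>The endpoint plan inherits the limit process's squared-distance bound by the
    squared Wasserstein distance, so it attains the infimum.\<close>
  proof (rule optimal_transference_planI[OF D plan])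
    have "continuous_on UNIV (\<lambda>p :: 'a \<times> 'a. (dist (fst p) (snd p))\<^sup>2)" by (intro continuous_intros)
    note b = borel_measurable_continuous_onI[OF this]
    have "(\<integral>(x, y). (dist x y)\<^sup>2 \<partial>\<pi>) = (\<integral>\<gamma>. (dist (\<gamma> 0) (\<gamma> 1))\<^sup>2 \<partial>\<Theta>)"
      unfolding \<pi>_def case_prod_unfold by (subst integral_distr[OF end_meas b]) (simp add: geodesic_endpoints_def)
    also have "\<dots> = (\<integral>c. (dist (F c 0) (F c 1))\<^sup>2 \<partial>M)"
      unfolding \<Theta>_def
      using measurable_compose[OF measurable_geodesic_endpoints b]
      by (subst integral_distr[OF Fm]) (simp_all add: geodesic_endpoints_def)
    also have "\<dots> = (\<integral>c. (dist (f i0 c) (f i1 c))\<^sup>2 \<partial>M)"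
    proof (rule Bochner_Integration.integral_cong[OF refl])
      fix c assume "c \<in> space M"
      then show "(dist (F c 0) (F c 1))\<^sup>2 = (dist (f i0 c) (f i1 c))\<^sup>2"
        using F(2)[of c i0] F(2)[of c i1] by (simp add: space q)
    qed
    finally show "(\<integral>(x, y). (dist x y)\<^sup>2 \<partial>\<pi>) \<le> (W2 (\<mu> 0) (\<mu> 1))\<^sup>2" using cost by simp
  qed
  then have "optimal_dynamical_transference_plan \<pi> \<Theta>"
    using plan \<Theta>.prob_space_axioms
    by (simp add: optimal_dynamical_transference_plan_def dynamical_transference_plan_def \<pi>_fst \<pi>_snd
        space_prob_algebra \<pi>_def[symmetric]) (simp add: \<Theta>_def)
  moreover have "\<mu> t = displacement_interpolation \<Theta> t" if t: "t \<in> {0..1}" for t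
  proof -
    have Ft: "(\<lambda>c. F c t) \<in> borel_measurable M"
      using measurable_compose[OF Fm measurable_geodesic_eval[OF t]] by (simp add: geodesic_eval_def)
    have "\<mu> t = distr M borel (\<lambda>c. F c t)"
    proof (rule measure_eqI_lipschitz)
      show "finite_measure (\<mu> t)" "sets (\<mu> t) = sets borel" using P2[OF t t] unfolding P2_iff
        by (auto intro: prob_space.finite_measure)
      show "finite_measure (distr M borel (\<lambda>c. F c t))"
        by (intro prob_space.finite_measure M.prob_space_distr Ft)
      fix g :: "'a \<Rightarrow> real" and L assume g: "L-lipschitz_on UNIV g" "\<And>x. \<bar>g x\<bar> \<le> 1"
      have gb: "g \<in> borel_measurable borel"
        by (rule borel_measurable_continuous_onI[OF lipschitz_on_continuous_on[OF g(1)]])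
      have L: "L \<ge> 0" by (rule lipschitz_on_nonneg[OF g(1)])
      \<comment> \<open>The first summand bounds the change of the integral along the given path of
        measures, the second its change along the geodesics. Both sides are thus Lipschitz in time
        and agree at the dense times \<open>q n\<close>.\<close>
      define K where "K = L * W2 (\<mu> 0) (\<mu> 1) + L * D"
      have est: "\<bar>integral\<^sup>L (\<mu> t) g - (\<integral>c. g (F c t) \<partial>M)\<bar> \<le> \<bar>t - q n\<bar> * K" for n
      proof -
        have "\<bar>integral\<^sup>L (\<mu> t) g - integral\<^sup>L (\<mu> (q n)) g\<bar> \<le> L * W2 (\<mu> t) (\<mu> (q n))"
          by (rule lipschitz_integral_diff_le_W2[OF D transference_plans_nonempty[OF compact P2[OF t t] P2[OF q01 t]] g])
        then have 1: "\<bar>integral\<^sup>L (\<mu> t) g - integral\<^sup>L (\<mu> (q n)) g\<bar> \<le> L * (\<bar>t - q n\<bar> * W2 (\<mu> 0) (\<mu> 1))"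
          using geo2[OF t q01[of n]] by simp
        have i: "integrable M (\<lambda>c. g (F c t))" "integrable M (\<lambda>c. g (f n c))"
          by (rule M.integrable_const_bound[of _ 1]; use g(2) measurable_compose[OF Ft gb] measurable_compose[OF f_meas gb] in simp)+
        have "integral\<^sup>L (\<mu> (q n)) g = (\<integral>c. g (f n c) \<partial>M)"
          unfolding law[symmetric] by (rule integral_distr[OF f_meas gb])
        then have "\<bar>integral\<^sup>L (\<mu> (q n)) g - (\<integral>c. g (F c t) \<partial>M)\<bar> = \<bar>\<integral>c. g (f n c) - g (F c t) \<partial>M\<bar>"
          using i by simp
        also have "\<dots> \<le> (\<integral>c. \<bar>g (f n c) - g (F c t)\<bar> \<partial>M)" by (rule integral_abs_bound)
        also have "\<dots> \<le> (\<integral>c. L * (\<bar>t - q n\<bar> * D) \<partial>M)"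
        proof (rule integral_mono)
          fix c assume "c \<in> space M"
          then have c: "c \<in> G" by (simp add: space)
          have "\<bar>g (f n c) - g (F c t)\<bar> \<le> L * dist (F c (q n)) (F c t)"
            using lipschitz_onD[OF g(1), of "f n c" "F c t"] by (simp add: dist_real_def F(2)[OF c])
          also have "dist (F c (q n)) (F c t) = \<bar>q n - t\<bar> * dist (F c 0) (F c 1)"
            using F(1)[OF c] q01[of n] t unfolding geodesics_def by blast
          also have "L * \<dots> \<le> L * (\<bar>t - q n\<bar> * D)"
            unfolding abs_minus_commute[of "q n"] by (intro mult_left_mono D L) auto
          finally show "\<bar>g (f n c) - g (F c t)\<bar> \<le> L * (\<bar>t - q n\<bar> * D)" .
        qed (use i in auto)
        also have "\<dots> = L * (\<bar>t - q n\<bar> * D)" by (simp add: M.prob_space)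
        finally show ?thesis using 1 by (simp add: K_def algebra_simps)
      qed
      have "integral\<^sup>L (\<mu> t) g - (\<integral>c. g (F c t) \<partial>M) = 0"
      proof (rule ccontr)
        define d where "d = \<bar>integral\<^sup>L (\<mu> t) g - (\<integral>c. g (F c t) \<partial>M)\<bar>"
        assume "integral\<^sup>L (\<mu> t) g - (\<integral>c. g (F c t) \<partial>M) \<noteq> 0"
        then have d: "d > 0" by (simp add: d_def)
        have "t \<in> closure (range q)" using t q(1) by simp
        \<comment> \<open>Adding 1 to the absolute value gives a positive upper bound for
          \<open>K\<close>, so the division is safe even for K = 0.\<close>
        moreover have "d / (\<bar>K\<bar> + 1) > 0" using d by (intro divide_pos_pos) auto
        ultimately obtain n where n: "dist (q n) t < d / (\<bar>K\<bar> + 1)" by (auto simp: closure_approachable)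
        have "d \<le> \<bar>t - q n\<bar> * K" using est[of n] by (simp add: d_def)
        also have "\<dots> \<le> \<bar>t - q n\<bar> * (\<bar>K\<bar> + 1)" by (intro mult_left_mono) auto
        also have "\<dots> < d" using n by (simp add: dist_real_def abs_minus_commute pos_less_divide_eq)
        finally show False by simp
      qed
      then show "integral\<^sup>L (\<mu> t) g = integral\<^sup>L (distr M borel (\<lambda>c. F c t)) g"
        using integral_distr[OF Ft gb] by simp
    qed simp
    then show ?thesis by (simp add: displacement_interpolation_def eval[OF t])
  qed
  ultimately show ?thesis by blast
qed

end
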